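(* Let $k$ be a field and let $H$ be a pointed coradically graded Hopf $k$-algebra with antipode $S$. \begin{enumerate} \item[(1)] $|S|=\infty$ if and only if $m_H=\infty$. \item[(2)] If $m_H<\infty$, then $S=\operatorname{id}$ or $|S|=2m_H$. \end{enumerate}
   Context: For a Hopf $k$-algebra $H$, $\Delta$, $\epsilon$, $S$ denote the coproduct, counit and antipode. The order $|S|$ is the minimal $n\ge 1$ with $S^n=\operatorname{id}$, and $|S|=\infty$ if there is no such $n$. The coradical filtration $\{H_n\}_{n\ge 0}$ is given by: $H_0$ is the sum of the simple subcoalgebras of $H$, and $H_n=\Delta^{-1}(H\otimes H_{n-1}+H_0\otimes H)$ for $n\ge 1$. $G(H)$ is the group of group-like elements ($\Delta(g)=g\otimes g$). $H$ is pointed if $H_0=kG(H)$. A family of subspaces $\{H(n)\}_{n\ge 0}$ is a Hopf algebra grading of $H$ if it is both an algebra grading and a coalgebra grading and $S(H(n))\subseteq H(n)$ for all $n\ge 0$. If in addition $H_n=\bigoplus_{i=0}^{n}H(i)$ for each $n\ge 0$, then $H$ is called a coradically graded Hopf algebra. Definition of $m_H$ for a pointed Hopf algebra $H$: for $x\in G(H)$ let $P_{x,1}(H)=\{h\in H:\Delta(h)=h\otimes x+1\otimes h\}$, a subspace stable under conjugation by $x$. Let $C_{\langle x\rangle}(P_{x,1}(H))$ be the subgroup of those elements of the cyclic group $\langle x\rangle\le G(H)$ which commute with every element of $P_{x,1}(H)$, and put $a_x=|\langle x\rangle:C_{\langle x\rangle}(P_{x,1}(H))|$ (the index, possibly $\infty$).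 Then $m_H=\operatorname{lcm}\{a_x:x\in G(H)\}$, with $m_H=\infty$ if some $a_x$ is infinite or if the $a_x$ have no finite common multiple. *)

theory Defs
  imports "HOL-Library.Poly_Mapping" "HOL-Library.Extended_Nat" "HOL-Algebra.Generated_Groups"
begin

section \<open>Tensor powers of a vector space\<close>

text \<open>The vector space with basis \<^typ>\<open>'p\<close> is \<^typ>\<open>'p \<Rightarrow>\<^sub>0 'k\<close>; its basis vectors
  are \<open>Poly_Mapping.single p 1\<close>. The spaces $V \otimes V$ and $V \otimes V \otimes V$ are the
  quotients of the free vector spaces on pairs and on triples of vectors by the multilinearity
  relations. Their elements are cosets, so for \<open>T\<close> in $V \otimes V$ the membership \<open>t \<in> T\<close> says
  that the formal linear combination \<open>t\<close> of pairs \<open>(a, b)\<close> is an expression of \<open>T\<close>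
  as a linear combination of pure tensors $a \otimes b$.\<close>

definition free_scale :: "'k::field \<Rightarrow> ('p \<Rightarrow>\<^sub>0 'k) \<Rightarrow> ('p \<Rightarrow>\<^sub>0 'k)" where
  "free_scale c = Poly_Mapping.map ((*) c)"

lemma lookup_free_scale [simp]: "Poly_Mapping.lookup (free_scale c t) p = c * Poly_Mapping.lookup t p"
  by (simp add: free_scale_def Poly_Mapping.map.rep_eq when_def)

lemma vector_space_free_scale: "vector_space free_scale"
  by unfold_locales (auto intro!: poly_mapping_eqI simp: lookup_add algebra_simps)

text \<open>The linear extension of a map defined on the basis \<^typ>\<open>'p\<close>.\<close>

definition lin_ext :: "('k::field \<Rightarrow> 'v::ab_group_add \<Rightarrow> 'v) \<Rightarrow> ('p \<Rightarrow> 'v) \<Rightarrow> ('p \<Rightarrow>\<^sub>0 'k) \<Rightarrow> 'v" where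
  "lin_ext s f t = (\<Sum>p\<in>Poly_Mapping.keys t. s (Poly_Mapping.lookup t p) (f p))"

text \<open>Linearity relations in one tensor slot: \<open>e a\<close> is the pair or triple with \<open>a\<close> in that slot
  and all other entries fixed.\<close>

definition slot_rels ::
  "('k::field \<Rightarrow> 'v::ab_group_add \<Rightarrow> 'v) \<Rightarrow> ('v \<Rightarrow> 'p) \<Rightarrow> ('p \<Rightarrow>\<^sub>0 'k) set" where
  "slot_rels s e =
     {Poly_Mapping.single (e (a + b)) 1 - Poly_Mapping.single (e a) 1 - Poly_Mapping.single (e b) 1
        | a b. True} \<union>
     {Poly_Mapping.single (e (s c a)) 1 - Poly_Mapping.single (e a) c | c a. True}"

definition tensor2_null :: "('k::field \<Rightarrow> 'v::ab_group_add \<Rightarrow> 'v) \<Rightarrow> ('v \<times> 'v \<Rightarrow>\<^sub>0 'k) set" where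
  "tensor2_null s = module.span free_scale
     ((\<Union>b. slot_rels s (\<lambda>a. (a, b))) \<union> (\<Union>a. slot_rels s (\<lambda>b. (a, b))))"

definition tensor3_null :: "('k::field \<Rightarrow> 'v::ab_group_add \<Rightarrow> 'v) \<Rightarrow> ('v \<times> 'v \<times> 'v \<Rightarrow>\<^sub>0 'k) set" where
  "tensor3_null s = module.span free_scale
     ((\<Union>b c. slot_rels s (\<lambda>a. (a, b, c))) \<union> (\<Union>a c. slot_rels s (\<lambda>b. (a, b, c))) \<union>
      (\<Union>a b. slot_rels s (\<lambda>c. (a, b, c))))"

definition tensor2_class ::
  "('k::field \<Rightarrow> 'v::ab_group_add \<Rightarrow> 'v) \<Rightarrow> ('v \<times> 'v \<Rightarrow>\<^sub>0 'k) \<Rightarrow> ('v \<times> 'v \<Rightarrow>\<^sub>0 'k) set" where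
  "tensor2_class s t = {u. u - t \<in> tensor2_null s}"

definition tensor2_space ::
  "('k::field \<Rightarrow> 'v::ab_group_add \<Rightarrow> 'v) \<Rightarrow> ('v \<times> 'v \<Rightarrow>\<^sub>0 'k) set set" where
  "tensor2_space s = range (tensor2_class s)"

text \<open>The linear combinations of pairs in \<open>A \<times> B\<close>; for subspaces \<open>A\<close> and \<open>B\<close> their classes form
  the subspace $A \otimes B$ of $V \otimes V$.\<close>

definition tensors_from :: "'v set \<Rightarrow> 'v set \<Rightarrow> ('v \<times> 'v \<Rightarrow>\<^sub>0 'k::zero) set" where
  "tensors_from A B = {t. Poly_Mapping.keys t \<subseteq> A \<times> B}"

definition tensor2_mult ::
  "('v \<times> 'v \<Rightarrow>\<^sub>0 'k) \<Rightarrow> ('v \<times> 'v \<Rightarrow>\<^sub>0 'k) \<Rightarrow> ('v::ring_1 \<times> 'v \<Rightarrow>\<^sub>0 'k::field)" where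
  "tensor2_mult t u = (\<Sum>p\<in>Poly_Mapping.keys t. \<Sum>q\<in>Poly_Mapping.keys u.
     Poly_Mapping.single (fst p * fst q, snd p * snd q) (Poly_Mapping.lookup t p * Poly_Mapping.lookup u q))"

text \<open>For \<open>d :: 'v \<Rightarrow> V \<otimes> V\<close> given by expressions, \<open>apply_left d\<close> and \<open>apply_right d\<close> are
  $d \otimes \mathrm{id}$ and $\mathrm{id} \otimes d$.\<close>

definition apply_left ::
  "('v \<Rightarrow> ('v \<times> 'v \<Rightarrow>\<^sub>0 'k)) \<Rightarrow> ('v \<times> 'v \<Rightarrow>\<^sub>0 'k) \<Rightarrow> ('v \<times> 'v \<times> 'v \<Rightarrow>\<^sub>0 'k::field)" where
  "apply_left d = lin_ext free_scale (\<lambda>(a, b).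
     lin_ext free_scale (\<lambda>(x, y). Poly_Mapping.single (x, y, b) 1) (d a))"

definition apply_right ::
  "('v \<Rightarrow> ('v \<times> 'v \<Rightarrow>\<^sub>0 'k)) \<Rightarrow> ('v \<times> 'v \<Rightarrow>\<^sub>0 'k) \<Rightarrow> ('v \<times> 'v \<times> 'v \<Rightarrow>\<^sub>0 'k::field)" where
  "apply_right d = lin_ext free_scale (\<lambda>(a, b).
     lin_ext free_scale (\<lambda>(x, y). Poly_Mapping.single (a, x, y) 1) (d b))"


section \<open>Hopf algebras\<close>

locale k_algebra = vector_space scale
  for scale :: "'k::field \<Rightarrow> 'h::ring_1 \<Rightarrow> 'h" (infixr \<open>*s\<close> 75) +
  assumes scale_mult_left: "(c *s a) * b = c *s (a * b)"
    and scale_mult_right: "a * (c *s b) = c *s (a * b)"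

text \<open>Since \<^class>\<open>ring_1\<close> has \<open>0 \<noteq> 1\<close>, the zero ring is excluded; the counit axioms
  exclude it in any case.\<close>

locale hopf_algebra = k_algebra scale
  for scale :: "'k::field \<Rightarrow> 'h::ring_1 \<Rightarrow> 'h" (infixr \<open>*s\<close> 75) +
  fixes \<Delta> :: "'h \<Rightarrow> ('h \<times> 'h \<Rightarrow>\<^sub>0 'k) set"
    and \<epsilon> :: "'h \<Rightarrow> 'k"
    and S :: "'h \<Rightarrow> 'h"
  assumes comult_in: "\<Delta> h \<in> tensor2_space scale"
    and comult_add: "\<lbrakk>t \<in> \<Delta> a; u \<in> \<Delta> b\<rbrakk> \<Longrightarrow> t + u \<in> \<Delta> (a + b)"
    and comult_scale: "t \<in> \<Delta> a \<Longrightarrow> free_scale c t \<in> \<Delta> (c *s a)"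
    and comult_one: "Poly_Mapping.single (1, 1) 1 \<in> \<Delta> 1"
    and comult_mult: "\<lbrakk>t \<in> \<Delta> a; u \<in> \<Delta> b\<rbrakk> \<Longrightarrow> tensor2_mult t u \<in> \<Delta> (a * b)"
    and coassoc: "(\<And>a. d a \<in> \<Delta> a) \<Longrightarrow>
      apply_left d (d h) - apply_right d (d h) \<in> tensor3_null scale"
    and counit_linear: "Vector_Spaces.linear scale (*) \<epsilon>"
    and counit_one: "\<epsilon> 1 = 1"
    and counit_mult: "\<epsilon> (a * b) = \<epsilon> a * \<epsilon> b"
    and counit_left: "t \<in> \<Delta> h \<Longrightarrow> lin_ext scale (\<lambda>(a, b). \<epsilon> a *s b) t = h"
    and counit_right: "t \<in> \<Delta> h \<Longrightarrow> lin_ext scale (\<lambda>(a, b). \<epsilon> b *s a) t = h"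
    and antipode_linear: "Vector_Spaces.linear scale scale S"
    and antipode_left: "t \<in> \<Delta> h \<Longrightarrow> lin_ext scale (\<lambda>(a, b). S a * b) t = \<epsilon> h *s 1"
    and antipode_right: "t \<in> \<Delta> h \<Longrightarrow> lin_ext scale (\<lambda>(a, b). a * S b) t = \<epsilon> h *s 1"
begin

definition subcoalgebra :: "'h set \<Rightarrow> bool" where
  "subcoalgebra C \<longleftrightarrow> subspace C \<and> (\<forall>h\<in>C. \<exists>t\<in>tensors_from C C. t \<in> \<Delta> h)"

definition simple_subcoalgebra :: "'h set \<Rightarrow> bool" where
  "simple_subcoalgebra C \<longleftrightarrow> subcoalgebra C \<and> C \<noteq> {0} \<and>
     (\<forall>D. subcoalgebra D \<longrightarrow> D \<subseteq> C \<longrightarrow> D = {0} \<or> D = C)"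

definition coradical :: "'h set" where
  "coradical = span (\<Union>{C. simple_subcoalgebra C})"

primrec coradical_filtration :: "nat \<Rightarrow> 'h set" where
  "coradical_filtration 0 = coradical"
| "coradical_filtration (Suc n) =
     {h. \<exists>t\<in>tensors_from UNIV (coradical_filtration n). \<exists>u\<in>tensors_from coradical UNIV. t + u \<in> \<Delta> h}"

definition group_likes :: "'h set" where
  "group_likes = {g. g \<noteq> 0 \<and> Poly_Mapping.single (g, g) 1 \<in> \<Delta> g}"

definition group_like_group :: "'h monoid" where
  "group_like_group = \<lparr>carrier = group_likes, monoid.mult = (*), one = 1\<rparr>"

definition pointed :: bool where
  "pointed \<longleftrightarrow> coradical = span group_likes"

definition skew_primitives :: "'h \<Rightarrow> 'h set" where
  "skew_primitives x =
     {h. Poly_Mapping.single (h, x) 1 + Poly_Mapping.single (1, h) 1 \<in> \<Delta> h}"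

definition cyclic_subgroup :: "'h \<Rightarrow> 'h set" where
  "cyclic_subgroup x = generate group_like_group {x}"

definition skew_centralizer :: "'h \<Rightarrow> 'h set" where
  "skew_centralizer x = {y \<in> cyclic_subgroup x. \<forall>h\<in>skew_primitives x. y * h = h * y}"

definition conj_index :: "'h \<Rightarrow> enat" where
  "conj_index x =
     (let Q = rcosets\<^bsub>group_like_group\<lparr>carrier := cyclic_subgroup x\<rparr>\<^esub> (skew_centralizer x)
      in if finite Q then enat (card Q) else \<infinity>)"

definition m_H :: enat where
  "m_H = (if \<exists>N\<ge>1. \<forall>x\<in>group_likes. \<exists>a. conj_index x = enat a \<and> a dvd N
          then enat (Lcm {a. \<exists>x\<in>group_likes. conj_index x = enat a}) else \<infinity>)"

text \<open>A direct sum decomposition of the whole space into the subspaces \<open>gr n\<close>.\<close>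

definition direct_sum_decomposition :: "(nat \<Rightarrow> 'h set) \<Rightarrow> bool" where
  "direct_sum_decomposition gr \<longleftrightarrow> (\<forall>n. subspace (gr n)) \<and>
     (\<forall>h. \<exists>!f :: nat \<Rightarrow>\<^sub>0 'h. (\<forall>n. Poly_Mapping.lookup f n \<in> gr n) \<and>
        h = (\<Sum>n\<in>Poly_Mapping.keys f. Poly_Mapping.lookup f n))"

definition algebra_grading :: "(nat \<Rightarrow> 'h set) \<Rightarrow> bool" where
  "algebra_grading gr \<longleftrightarrow> direct_sum_decomposition gr \<and> 1 \<in> gr 0 \<and>
     (\<forall>m n. \<forall>a\<in>gr m. \<forall>b\<in>gr n. a * b \<in> gr (m + n))"

definition coalgebra_grading :: "(nat \<Rightarrow> 'h set) \<Rightarrow> bool" where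
  "coalgebra_grading gr \<longleftrightarrow> direct_sum_decomposition gr \<and>
     (\<forall>n. \<forall>h\<in>gr n. \<exists>t. (\<forall>i\<le>n. t i \<in> tensors_from (gr i) (gr (n - i))) \<and> (\<Sum>i\<le>n. t i) \<in> \<Delta> h) \<and>
     (\<forall>n\<ge>1. \<forall>h\<in>gr n. \<epsilon> h = 0)"

definition hopf_grading :: "(nat \<Rightarrow> 'h set) \<Rightarrow> bool" where
  "hopf_grading gr \<longleftrightarrow> algebra_grading gr \<and> coalgebra_grading gr \<and> (\<forall>n. S ` gr n \<subseteq> gr n)"

text \<open>Directness of the sums of the \<open>gr i\<close> with \<open>i \<le> n\<close> is part of \<open>hopf_grading gr\<close>.\<close>

definition coradical_grading :: "(nat \<Rightarrow> 'h set) \<Rightarrow> bool" where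
  "coradical_grading gr \<longleftrightarrow> hopf_grading gr \<and>
     (\<forall>n. coradical_filtration n = {\<Sum>i\<le>n. f i | f. \<forall>i\<le>n. f i \<in> gr i})"

end

text \<open>The order of a map under composition.\<close>

definition map_order :: "('a \<Rightarrow> 'a) \<Rightarrow> enat" where
  "map_order f = (if \<exists>n\<ge>1. f ^^ n = id then enat (LEAST n. n \<ge> 1 \<and> f ^^ n = id) else \<infinity>)"

end

(*
  On P_{x,1}(H) one has S h = - h x^-1, so S^2 h = x h x^-1 and S^(2n) fixes P_{x,1}(H) exactly
  when x^n centralises it, that is, when the index a_x divides n. The component H(1) is spanned by
  left translates of skew-primitives, since the coefficient functionals of the group-likes split
  its left and right H(0)-coactions. The coalgebra map S^(2n) is therefore the identity on H(0) and
  H(1) as soon as every a_x divides n, and then on all of H: by induction on the degree m >= 2,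
  S^(2n) h - h lies in H_1 and in H(m), so it is 0. If S has odd order n, then g = S g for every
  group-like g, hence x^2 = 1 and x^n = x; since S^(2n) = id, already S^2 = id, and so S = id.
*)
theory Submission
  imports Defs "HOL-Algebra.Multiplicative_Group"
begin

section \<open>Linear extensions and tensors\<close>

text \<open>The coproduct takes cosets as values, so identities in the tensor square are not
  compared term by term: a separating functional shows that an expression is null exactly when every
  scalar bilinear form kills it, and coproducts are computed as Sweedler sums of an arbitrary form.
  The axioms say nothing about the coproduct of S h; that S reverses coproducts follows from the
  uniqueness of convolution inverses, and this is what makes the even powers of S coalgebra maps.
  Besides closing the induction on the degree, the grading provides the projection onto H(0), hence
  coefficient functionals defined on all of H. They are orthogonal idempotents under convolution,
  which is why they cut H(1) into skew-primitive pieces. The factor 2 in the order appears because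
  commutation with x^n controls only S^(2n), so odd exponents need an argument of their own.
  Infinite indices fit the same divisibility criterion: an infinite set has cardinality 0, and 0
  divides no positive n.\<close>

interpretation free: vector_space "free_scale :: 'k::field \<Rightarrow> ('p \<Rightarrow>\<^sub>0 'k) \<Rightarrow> ('p \<Rightarrow>\<^sub>0 'k)"
  by (rule vector_space_free_scale)

lemma vector_space_field: "vector_space ((*) :: 'k::field \<Rightarrow> 'k \<Rightarrow> 'k)"
  by (simp add: vector_space_def distrib_left distrib_right)

interpretation free_forms: vector_space_pair
  "free_scale :: 'k::field \<Rightarrow> ('p \<Rightarrow>\<^sub>0 'k) \<Rightarrow> ('p \<Rightarrow>\<^sub>0 'k)" "(*) :: 'k \<Rightarrow> 'k \<Rightarrow> 'k"
  by (rule vector_space_pair.intro[OF vector_space_free_scale vector_space_field])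

lemma free_scale_single [simp]: "free_scale c (Poly_Mapping.single p d) = Poly_Mapping.single p (c * d)"
  by (rule poly_mapping_eqI) (simp add: lookup_single when_def)

lemma keys_free_scale: "Poly_Mapping.keys (free_scale c t) \<subseteq> Poly_Mapping.keys t"
  by (auto simp: in_keys_iff)

lemma linear_sumI:
  assumes "finite A" "vector_space s" "vector_space s'"
    and "\<And>i. i \<in> A \<Longrightarrow> Vector_Spaces.linear s s' (f i)"
  shows "Vector_Spaces.linear s s' (\<lambda>x. \<Sum>i\<in>A. f i x)"
proof -
  interpret vector_space_pair s s' using assms(2,3) by (rule vector_space_pair.intro)
  show ?thesis by (rule linear_compose_sum) (simp add: assms(4))
qed

context vector_space
begin

text \<open>Supports change under addition and scaling; summing over a common finite superset makes
  the linearity of \<open>lin_ext\<close> a termwise computation.\<close>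

lemma lin_ext_superset:
  assumes "finite A" "Poly_Mapping.keys t \<subseteq> A"
  shows "lin_ext scale f t = (\<Sum>p\<in>A. scale (Poly_Mapping.lookup t p) (f p))"
  unfolding lin_ext_def using assms
  by (intro sum.mono_neutral_left) (auto simp: in_keys_iff)

lemma linear_lin_ext: "Vector_Spaces.linear free_scale scale (lin_ext scale f)"
proof (rule Vector_Spaces.linear_iff[THEN iffD2], intro conjI allI)
  fix t u :: "'c \<Rightarrow>\<^sub>0 'a"
  let ?A = "Poly_Mapping.keys t \<union> Poly_Mapping.keys u"
  have "lin_ext scale f (t + u) = (\<Sum>p\<in>?A. scale (Poly_Mapping.lookup (t + u) p) (f p))"
    by (intro lin_ext_superset Poly_Mapping.keys_add) auto
  also have "\<dots> = lin_ext scale f t + lin_ext scale f u"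
    by (simp add: lin_ext_superset[of ?A] lookup_add scale_left_distrib sum.distrib)
  finally show "lin_ext scale f (t + u) = lin_ext scale f t + lin_ext scale f u" .
next
  fix c and t :: "'c \<Rightarrow>\<^sub>0 'a"
  have "lin_ext scale f (free_scale c t) =
      (\<Sum>p\<in>Poly_Mapping.keys t. scale (Poly_Mapping.lookup (free_scale c t) p) (f p))"
    by (intro lin_ext_superset keys_free_scale) auto
  also have "\<dots> = scale c (lin_ext scale f t)"
    by (simp add: lin_ext_def scale_sum_right)
  finally show "lin_ext scale f (free_scale c t) = scale c (lin_ext scale f t)" .
qed (rule vector_space_free_scale, rule vector_space_axioms)

lemmas lin_ext_add = linear_lin_ext[THEN Vector_Spaces.linear_iff[THEN iffD1], THEN conjunct2, THEN conjunct2,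
    THEN conjunct1, rule_format]
  and lin_ext_free_scale = linear_lin_ext[THEN Vector_Spaces.linear_iff[THEN iffD1], THEN conjunct2, THEN conjunct2,
    THEN conjunct2, rule_format]

lemma lin_ext_zero [simp]: "lin_ext scale f 0 = 0"
  by (simp add: lin_ext_def)

lemma lin_ext_diff: "lin_ext scale f (t - u) = lin_ext scale f t - lin_ext scale f u"
  using lin_ext_add[of f "t - u" u] by simp

lemma lin_ext_sum: "lin_ext scale f (sum t A) = (\<Sum>i\<in>A. lin_ext scale f (t i))"
  by (induction A rule: infinite_finite_induct) (simp_all add: lin_ext_add)

lemma lin_ext_single [simp]: "lin_ext scale f (Poly_Mapping.single p c) = scale c (f p)"
  by (simp add: lin_ext_def)

lemma lin_ext_cong:
  "(\<And>p. p \<in> Poly_Mapping.keys t \<Longrightarrow> f p = g p) \<Longrightarrow> lin_ext scale f t = lin_ext scale g t"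
  by (simp add: lin_ext_def)

lemma lin_ext_eq_0: "(\<And>p. p \<in> Poly_Mapping.keys t \<Longrightarrow> f p = 0) \<Longrightarrow> lin_ext scale f t = 0"
  by (simp add: lin_ext_def)

lemma lin_ext_in_subspace:
  "subspace W \<Longrightarrow> (\<And>p. p \<in> Poly_Mapping.keys t \<Longrightarrow> f p \<in> W) \<Longrightarrow> lin_ext scale f t \<in> W"
  unfolding lin_ext_def by (intro subspace_sum subspace_scale)

lemma linear_of_lin_ext:
  assumes "Vector_Spaces.linear scale s' g"
  shows "g (lin_ext scale f t) = lin_ext s' (\<lambda>p. g (f p)) t"
proof -
  interpret g: Vector_Spaces.linear scale s' g by (rule assms)
  show ?thesis by (simp add: lin_ext_def g.sum g.scale)
qed

lemma linear_lin_ext_param: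
  assumes "vector_space s" "\<And>p. Vector_Spaces.linear s scale (\<lambda>z. f z p)"
  shows "Vector_Spaces.linear s scale (\<lambda>z. lin_ext scale (f z) t)"
proof -
  interpret vs: vector_space_pair s scale
    using assms(1) vector_space_axioms by (rule vector_space_pair.intro)
  show ?thesis
    unfolding lin_ext_def
    by (rule linear_sumI[OF finite_keys assms(1) vector_space_axioms])
       (rule vs.linear_compose_scale_right[OF assms(2)])
qed

lemma lin_ext_swap:
  "lin_ext scale (\<lambda>p. lin_ext scale (f p) u) t = lin_ext scale (\<lambda>q. lin_ext scale (\<lambda>p. f p q) t) u"
  unfolding lin_ext_def scale_sum_right
  by (subst sum.swap) (simp add: mult.commute)

lemma lin_ext_slot_rels:
  assumes "Vector_Spaces.linear s scale (\<lambda>a. f (e a))" "t \<in> slot_rels s e"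
  shows "lin_ext scale f t = 0"
proof -
  interpret f: Vector_Spaces.linear s scale "\<lambda>a. f (e a)" by (rule assms)
  show ?thesis
    using assms(2) by (auto simp: slot_rels_def lin_ext_diff f.add f.scale)
qed

lemma lin_ext_vanishes_on_span:
  assumes "\<And>t. t \<in> R \<Longrightarrow> lin_ext scale f t = 0" "t \<in> module.span free_scale R"
  shows "lin_ext scale f t = 0"
proof -
  interpret f: Vector_Spaces.linear free_scale scale "lin_ext scale f" by (rule linear_lin_ext)
  show ?thesis using f.eq_0_on_span[of R t] assms by blast
qed

text \<open>The universal property of the tensor square in the form that is used: linearity in each
  entry kills every generating relation, hence their span.\<close>

lemma lin_ext_tensor2_null:
  assumes "\<And>b. Vector_Spaces.linear s scale (\<lambda>a. f (a, b))"
    and "\<And>a. Vector_Spaces.linear s scale (\<lambda>b. f (a, b))"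
    and "t \<in> tensor2_null s"
  shows "lin_ext scale f t = 0"
  using assms(3) unfolding tensor2_null_def
  by (rule lin_ext_vanishes_on_span[rotated]) (elim UnE UN_E; erule lin_ext_slot_rels[rotated]; rule assms)

lemma lin_ext_tensor3_null:
  assumes "\<And>b c. Vector_Spaces.linear s scale (\<lambda>a. f (a, b, c))"
    and "\<And>a c. Vector_Spaces.linear s scale (\<lambda>b. f (a, b, c))"
    and "\<And>a b. Vector_Spaces.linear s scale (\<lambda>c. f (a, b, c))"
    and "t \<in> tensor3_null s"
  shows "lin_ext scale f t = 0"
  using assms(4) unfolding tensor3_null_def
  by (rule lin_ext_vanishes_on_span[rotated]) (elim UnE UN_E; erule lin_ext_slot_rels[rotated]; rule assms)

end

text \<open>Support control: it lets one see in which H(i) \<otimes> H(j) an expression stays after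
  a map has been applied to its tensor factors.\<close>

lemma keys_lin_ext_free_scale:
  "Poly_Mapping.keys (lin_ext free_scale f t) \<subseteq> (\<Union>p\<in>Poly_Mapping.keys t. Poly_Mapping.keys (f p))"
proof -
  have "Poly_Mapping.keys (lin_ext free_scale f t) \<subseteq>
      (\<Union>p\<in>Poly_Mapping.keys t. Poly_Mapping.keys (free_scale (Poly_Mapping.lookup t p) (f p)))"
    unfolding lin_ext_def by (rule Poly_Mapping.keys_sum)
  also have "\<dots> \<subseteq> (\<Union>p\<in>Poly_Mapping.keys t. Poly_Mapping.keys (f p))"
    by (intro UN_mono subset_refl keys_free_scale)
  finally show ?thesis .
qed

lemma lin_ext_single_id: "lin_ext free_scale (\<lambda>p. Poly_Mapping.single p 1) t = t"
  by (rule poly_mapping_eqI)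
     (auto simp: lin_ext_def lookup_sum lookup_single when_def in_keys_iff sum.delta)

lemma tensor2_mult_lin_ext:
  "tensor2_mult t u = lin_ext free_scale (\<lambda>p. lin_ext free_scale
     (\<lambda>q. Poly_Mapping.single (fst p * fst q, snd p * snd q) 1) u) t"
  by (simp add: tensor2_mult_def lin_ext_def free.scale_sum_right mult.assoc)

lemma tensor2_null_subspace: "free.subspace (tensor2_null s)"
  unfolding tensor2_null_def by (rule free.subspace_span)

text \<open>Adjoin \<open>t\<close> to a basis of \<open>N\<close> and extend to the whole space the
  functional that is 1 at \<open>t\<close> and 0 on the basis.\<close>

lemma exists_separating_form:
  fixes t :: "'p \<Rightarrow>\<^sub>0 'k::field"
  assumes "free.subspace N" "t \<notin> N"
  obtains \<phi> where "Vector_Spaces.linear free_scale (*) \<phi>" "\<And>u. u \<in> N \<Longrightarrow> \<phi> u = (0::'k)" "\<phi> t = 1"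
proof -
  obtain B where B: "B \<subseteq> N" "free.independent B" "N \<subseteq> free.span B" 
    using free.maximal_independent_subset[of N] by blast
  have N: "free.span B = N"
    using B assms(1) by (meson free.span_minimal subset_antisym)
  then have "t \<notin> free.span B" using assms(2) by blast
  with B have "free.independent (insert t B)" "t \<notin> B"
    by (auto simp: free.independent_insert intro: free.span_base)
  then obtain \<phi> where \<phi>: "Vector_Spaces.linear free_scale (*) \<phi>"
    "\<forall>u\<in>insert t B. \<phi> u = (if u = t then 1 else 0)"
    using free_forms.linear_independent_extend[of "insert t B" "\<lambda>u. if u = t then 1 else 0"] by blast
  interpret \<phi>: Vector_Spaces.linear free_scale "(*)" \<phi> by (rule \<phi>)
  have "\<phi> u = 0" if "u \<in> N" for u
    using \<phi>.eq_0_on_span[of B u] \<phi>(2) \<open>t \<notin> B\<close> that N by (metis insert_iff)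
  with \<phi> show thesis by (intro that[of \<phi>]) auto
qed

context k_algebra
begin

lemma vector_space_scale: "vector_space scale" ..

lemma lin_ext_bilinear_form:
  assumes "Vector_Spaces.linear free_scale ((*) :: 'k \<Rightarrow> 'k \<Rightarrow> 'k) \<phi>"
  shows "\<phi> t = lin_ext (*) (\<lambda>p. \<phi> (Poly_Mapping.single p 1)) t"
  using free.linear_of_lin_ext[OF assms, of "\<lambda>p. Poly_Mapping.single p 1" t]
  by (simp add: lin_ext_single_id)

text \<open>Converse direction to \<open>lin_ext_slot_rels\<close>: the relations of a slot express
  exactly additivity and homogeneity in that slot.\<close>

lemma slot_rels_linear:
  assumes "vector_space s'" "Vector_Spaces.linear free_scale s' \<phi>"
    and "\<And>t. t \<in> slot_rels scale e \<Longrightarrow> \<phi> t = 0"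
  shows "Vector_Spaces.linear scale s' (\<lambda>a. \<phi> (Poly_Mapping.single (e a) 1))"
proof -
  interpret \<phi>: Vector_Spaces.linear free_scale s' \<phi> by (rule assms)
  show ?thesis
    unfolding Vector_Spaces.linear_iff
  proof (intro conjI allI)
    fix a b
    have "\<phi> (Poly_Mapping.single (e (a + b)) 1 - Poly_Mapping.single (e a) 1 - Poly_Mapping.single (e b) 1) = 0"
      by (rule assms(3)) (auto simp: slot_rels_def)
    then show "\<phi> (Poly_Mapping.single (e (a + b)) 1) =
        \<phi> (Poly_Mapping.single (e a) 1) + \<phi> (Poly_Mapping.single (e b) 1)"
      unfolding \<phi>.diff by (simp add: diff_diff_eq)
  next
    fix c a
    have "\<phi> (Poly_Mapping.single (e (c *s a)) 1 - free_scale c (Poly_Mapping.single (e a) 1)) = 0"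
      by (rule assms(3)) (auto simp: slot_rels_def)
    then show "\<phi> (Poly_Mapping.single (e (c *s a)) 1) = s' c (\<phi> (Poly_Mapping.single (e a) 1))"
      by (simp only: \<phi>.diff \<phi>.scale right_minus_eq)
  qed (rule vector_space_axioms assms(1))+
qed

text \<open>The scalar action of the target is a parameter, so that one calculus covers both scalar
  forms and maps with values in H.\<close>

definition bilinear :: "('k \<Rightarrow> 'w::ab_group_add \<Rightarrow> 'w) \<Rightarrow> ('h \<Rightarrow> 'h \<Rightarrow> 'w) \<Rightarrow> bool" where
  "bilinear s' B \<longleftrightarrow> (\<forall>b. Vector_Spaces.linear scale s' (\<lambda>a. B a b)) \<and>
     (\<forall>a. Vector_Spaces.linear scale s' (B a))"

lemma bilinearI:
  "(\<And>b. Vector_Spaces.linear scale s' (\<lambda>a. B a b)) \<Longrightarrow>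
   (\<And>a. Vector_Spaces.linear scale s' (\<lambda>b. B a b)) \<Longrightarrow> bilinear s' B"
  by (simp add: bilinear_def)

text \<open>Over a field bilinear forms detect nonzero tensors: a functional that separates
  \<open>t\<close> from the null space becomes a bilinear form when restricted to pure
  tensors.\<close>

lemma in_tensor2_null_iff:
  "t \<in> tensor2_null scale \<longleftrightarrow>
     (\<forall>B. bilinear (*) B \<longrightarrow> lin_ext (*) (\<lambda>(a, b). B a b) t = 0)"
proof
  assume "t \<in> tensor2_null scale"
  then show "\<forall>B. bilinear (*) B \<longrightarrow> lin_ext (*) (\<lambda>(a, b). B a b) t = 0"
    by (intro allI impI vector_space.lin_ext_tensor2_null[OF vector_space_field])
       (simp_all add: bilinear_def)
next
  assume B: "\<forall>B. bilinear (*) B \<longrightarrow> lin_ext (*) (\<lambda>(a, b). B a b) t = 0"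
  show "t \<in> tensor2_null scale"
  proof (rule ccontr)
    assume "t \<notin> tensor2_null scale"
    then obtain \<phi> where \<phi>: "Vector_Spaces.linear free_scale (*) \<phi>"
      "\<And>u. u \<in> tensor2_null scale \<Longrightarrow> \<phi> u = (0::'k)" "\<phi> t = 1"
      using exists_separating_form[OF tensor2_null_subspace] by metis
    have "bilinear (*) (\<lambda>a b. \<phi> (Poly_Mapping.single (a, b) 1))"
      by (intro bilinearI; rule slot_rels_linear[OF vector_space_field \<phi>(1)], rule \<phi>(2))
         (force simp: tensor2_null_def intro!: free.span_base)+
    then have "lin_ext (*) (\<lambda>(a, b). \<phi> (Poly_Mapping.single (a, b) 1)) t = 0"
      using B by blast
    with lin_ext_bilinear_form[OF \<phi>(1), of t] \<phi>(3) show False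
      by (simp add: case_prod_unfold)
  qed
qed

end

section \<open>The antipode is an anti-coalgebra map\<close>

lemma linear_imp_vector_space:
  assumes "Vector_Spaces.linear s s' f"
  shows "vector_space s" "vector_space s'"
  using assms by (simp_all add: Vector_Spaces.linear_iff)

context k_algebra
begin

lemma bilinear_imp_vector_space: "bilinear s' B \<Longrightarrow> vector_space s'"
  unfolding bilinear_def by (blast dest: linear_imp_vector_space(2))

lemma linear_ident: "Vector_Spaces.linear scale scale (\<lambda>z. z)"
  by (simp add: Vector_Spaces.linear_iff vector_space_scale)

lemma linear_mult_const:
  "Vector_Spaces.linear scale scale g \<Longrightarrow> Vector_Spaces.linear scale scale (\<lambda>z. g z * c)"
  by (simp add: Vector_Spaces.linear_iff distrib_right scale_mult_left)

lemma linear_const_mult: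
  "Vector_Spaces.linear scale scale g \<Longrightarrow> Vector_Spaces.linear scale scale (\<lambda>z. c * g z)"
  by (simp add: Vector_Spaces.linear_iff distrib_left scale_mult_right)

lemma linear_comp:
  "Vector_Spaces.linear scale s' f \<Longrightarrow> Vector_Spaces.linear scale scale g \<Longrightarrow>
    Vector_Spaces.linear scale s' (\<lambda>z. f (g z))"
  by (simp add: Vector_Spaces.linear_iff)

lemma bilinear_linear_left:
  "bilinear s' B \<Longrightarrow> Vector_Spaces.linear scale scale g \<Longrightarrow>
    Vector_Spaces.linear scale s' (\<lambda>z. B (g z) c)"
  unfolding bilinear_def by (rule linear_comp[of s' "\<lambda>a. B a c" g]) blast+

lemma bilinear_linear_right:
  "bilinear s' B \<Longrightarrow> Vector_Spaces.linear scale scale g \<Longrightarrow>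
    Vector_Spaces.linear scale s' (\<lambda>z. B c (g z))"
  unfolding bilinear_def by (rule linear_comp[of s' "B c" g]) blast+

end

section \<open>Sweedler sums and their multilinear calculus\<close>

context hopf_algebra
begin

sublocale S: Vector_Spaces.linear scale scale S by (rule antipode_linear)
sublocale \<epsilon>: Vector_Spaces.linear scale "(*)" \<epsilon> by (rule counit_linear)

lemma linear_antipode_comp:
  "Vector_Spaces.linear scale scale g \<Longrightarrow> Vector_Spaces.linear scale scale (\<lambda>z. S (g z))"
  by (rule linear_comp[OF antipode_linear])

lemma ex_comult: "\<exists>t. t \<in> \<Delta> h"
proof -
  obtain t where "\<Delta> h = tensor2_class scale t"
    using comult_in[of h] by (auto simp: tensor2_space_def)
  then have "t \<in> \<Delta> h"
    by (simp add: tensor2_class_def free.subspace_0[OF tensor2_null_subspace])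
  then show ?thesis ..
qed

lemma in_comult_iff: "t \<in> \<Delta> h \<Longrightarrow> u \<in> \<Delta> h \<longleftrightarrow> u - t \<in> tensor2_null scale"
proof -
  assume t: "t \<in> \<Delta> h"
  obtain v where v: "\<Delta> h = tensor2_class scale v"
    using comult_in[of h] by (auto simp: tensor2_space_def)
  have tv: "t - v \<in> tensor2_null scale" using t v by (simp add: tensor2_class_def)
  have "u - v \<in> tensor2_null scale \<longleftrightarrow> u - t \<in> tensor2_null scale"
    using free.subspace_diff[OF tensor2_null_subspace _ tv, of "u - v"]
      free.subspace_add[OF tensor2_null_subspace _ tv, of "u - t"] by auto
  then show ?thesis by (simp add: v tensor2_class_def)
qed

lemma comult_diff: "\<lbrakk>t \<in> \<Delta> a; u \<in> \<Delta> b\<rbrakk> \<Longrightarrow> t - u \<in> \<Delta> (a - b)"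
proof -
  assume "t \<in> \<Delta> a" "u \<in> \<Delta> b"
  then have "t + free_scale (-1) u \<in> \<Delta> (a + (-1) *s b)"
    by (intro comult_add comult_scale)
  then show ?thesis
    by (simp add: free.scale_minus_left[of 1, simplified] scale_minus_left[of 1, simplified])
qed

text \<open>The Sweedler sum $\sum F(h_{(1)}, h_{(2)})$.\<close>

definition sweedler :: "('k \<Rightarrow> 'w::ab_group_add \<Rightarrow> 'w) \<Rightarrow> 'h \<Rightarrow> ('h \<Rightarrow> 'h \<Rightarrow> 'w) \<Rightarrow> 'w" where
  "sweedler s' h F = lin_ext s' (\<lambda>(a, b). F a b) (SOME t. t \<in> \<Delta> h)"

lemma some_comult: "(SOME t. t \<in> \<Delta> h) \<in> \<Delta> h"
  using ex_comult by (rule someI_ex)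

text \<open>Two representatives of \<Delta> h differ by a null tensor, which a bilinear map kills.
  Hence the arbitrary choice made in \<open>sweedler\<close> is harmless.\<close>

lemma lin_ext_comult:
  assumes "bilinear s' F" "t \<in> \<Delta> h"
  shows "lin_ext s' (\<lambda>(a, b). F a b) t = sweedler s' h F"
proof -
  interpret W: vector_space s' using assms(1) by (rule bilinear_imp_vector_space)
  have "t - (SOME t. t \<in> \<Delta> h) \<in> tensor2_null scale"
    using assms(2) in_comult_iff[OF some_comult] by blast
  then have "lin_ext s' (\<lambda>(a, b). F a b) (t - (SOME t. t \<in> \<Delta> h)) = 0"
    using assms(1) by (intro W.lin_ext_tensor2_null[of scale]) (simp_all add: bilinear_def)
  then show ?thesis by (simp add: W.lin_ext_diff sweedler_def)
qed

lemma linear_sweedler_arg: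
  assumes "bilinear s' F" "Vector_Spaces.linear scale scale g"
  shows "Vector_Spaces.linear scale s' (\<lambda>z. sweedler s' (g z) F)"
proof -
  interpret W: vector_space s' using assms(1) by (rule bilinear_imp_vector_space)
  have "sweedler s' (a + b) F = sweedler s' a F + sweedler s' b F" for a b
    using lin_ext_comult[OF assms(1) comult_add[OF some_comult some_comult], of a b]
    by (simp add: W.lin_ext_add sweedler_def)
  moreover have "sweedler s' (c *s a) F = s' c (sweedler s' a F)" for c a
    using lin_ext_comult[OF assms(1) comult_scale[OF some_comult], of c a]
    by (simp add: W.lin_ext_free_scale sweedler_def)
  ultimately have "Vector_Spaces.linear scale s' (\<lambda>z. sweedler s' z F)"
    by (simp add: Vector_Spaces.linear_iff vector_space_scale W.vector_space_axioms)
  then show ?thesis using assms(2) by (rule linear_comp)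
qed

lemma linear_sweedler_param:
  assumes "vector_space s'" "\<And>a b. Vector_Spaces.linear scale s' (\<lambda>z. F z a b)"
  shows "Vector_Spaces.linear scale s' (\<lambda>z. sweedler s' h (F z))"
  unfolding sweedler_def case_prod_unfold
  by (rule vector_space.linear_lin_ext_param[OF assms(1) vector_space_scale assms(2)])

text \<open>These rules follow the syntax of nested Sweedler expressions and so discharge the
  multilinearity side conditions mechanically.\<close>

lemmas linear_intros = linear_ident linear_mult_const linear_const_mult linear_antipode_comp
  linear_sweedler_arg linear_sweedler_param

lemma sweedler_swap:
  assumes "vector_space s'"
  shows "sweedler s' h (\<lambda>a b. sweedler s' k (\<lambda>x y. F a b x y)) =
    sweedler s' k (\<lambda>x y. sweedler s' h (\<lambda>a b. F a b x y))"
  unfolding sweedler_def case_prod_unfold by (rule vector_space.lin_ext_swap[OF assms])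

lemma sweedler_scale:
  assumes "vector_space s'"
  shows "sweedler s' h (\<lambda>a b. s' c (F a b)) = s' c (sweedler s' h F)"
proof -
  interpret W: vector_space s' by (rule assms)
  show ?thesis
    by (simp add: sweedler_def lin_ext_def case_prod_unfold W.scale_sum_right mult.commute)
qed

lemma sweedler_counit_left:
  assumes "Vector_Spaces.linear scale s' f"
  shows "sweedler s' h (\<lambda>a b. s' (\<epsilon> a) (f b)) = f h"
proof -
  interpret f: Vector_Spaces.linear scale s' f by (rule assms)
  show ?thesis
    using linear_of_lin_ext[OF assms, of "\<lambda>(a, b). \<epsilon> a *s b" "SOME t. t \<in> \<Delta> h"]
    by (simp add: sweedler_def counit_left[OF some_comult, unfolded case_prod_unfold] case_prod_unfold f.scale)
qed

lemma sweedler_counit_right: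
  assumes "Vector_Spaces.linear scale s' f"
  shows "sweedler s' h (\<lambda>a b. s' (\<epsilon> b) (f a)) = f h"
proof -
  interpret f: Vector_Spaces.linear scale s' f by (rule assms)
  show ?thesis
    using linear_of_lin_ext[OF assms, of "\<lambda>(a, b). \<epsilon> b *s a" "SOME t. t \<in> \<Delta> h"]
    by (simp add: sweedler_def counit_right[OF some_comult, unfolded case_prod_unfold] case_prod_unfold f.scale)
qed

lemma sweedler_antipode_left:
  assumes "Vector_Spaces.linear scale s' f"
  shows "sweedler s' h (\<lambda>a b. f (S a * b)) = s' (\<epsilon> h) (f 1)"
proof -
  interpret f: Vector_Spaces.linear scale s' f by (rule assms)
  show ?thesis
    using linear_of_lin_ext[OF assms, of "\<lambda>(a, b). S a * b" "SOME t. t \<in> \<Delta> h"]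
    by (simp add: sweedler_def antipode_left[OF some_comult, unfolded case_prod_unfold] case_prod_unfold f.scale)
qed

lemma sweedler_antipode_right:
  assumes "Vector_Spaces.linear scale s' f"
  shows "sweedler s' h (\<lambda>a b. f (a * S b)) = s' (\<epsilon> h) (f 1)"
proof -
  interpret f: Vector_Spaces.linear scale s' f by (rule assms)
  show ?thesis
    using linear_of_lin_ext[OF assms, of "\<lambda>(a, b). a * S b" "SOME t. t \<in> \<Delta> h"]
    by (simp add: sweedler_def antipode_right[OF some_comult, unfolded case_prod_unfold] case_prod_unfold f.scale)
qed

lemma sweedler_one: "bilinear s' F \<Longrightarrow> sweedler s' 1 F = F 1 1"
  using lin_ext_comult[of s' F, OF _ comult_one]
  by (simp add: vector_space.lin_ext_single bilinear_imp_vector_space vector_space.vector_space_assms)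

lemma sweedler_mult:
  assumes "bilinear s' F"
  shows "sweedler s' (a * b) F = sweedler s' a (\<lambda>x y. sweedler s' b (\<lambda>u v. F (x * u) (y * v)))"
proof -
  interpret W: vector_space s' using assms(1) by (rule bilinear_imp_vector_space)
  show ?thesis
    using lin_ext_comult[OF assms comult_mult[OF some_comult some_comult], of a b]
    unfolding tensor2_mult_lin_ext free.linear_of_lin_ext[OF W.linear_lin_ext]
    by (simp add: sweedler_def case_prod_unfold)
qed

lemma sweedler_coassoc:
  assumes "\<And>b c. Vector_Spaces.linear scale s' (\<lambda>a. F a b c)"
    and "\<And>a c. Vector_Spaces.linear scale s' (\<lambda>b. F a b c)"
    and "\<And>a b. Vector_Spaces.linear scale s' (\<lambda>c. F a b c)"
  shows "sweedler s' h (\<lambda>a c. sweedler s' a (\<lambda>x y. F x y c)) =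
    sweedler s' h (\<lambda>a b. sweedler s' b (\<lambda>x y. F a x y))"
proof -
  interpret W: vector_space s' using assms(1) by (rule linear_imp_vector_space)
  \<comment> \<open>Coassociativity is stated for an arbitrary choice of representatives. Taking the
    choice that underlies \<open>sweedler\<close> turns both sides into nested Sweedler
    sums.\<close>
  define d where "d h = (SOME t. t \<in> \<Delta> h)" for h
  define f where "f = (\<lambda>(a, b, c). F a b c)"
  have "lin_ext s' f (apply_left d (d h) - apply_right d (d h)) = 0"
  proof (rule W.lin_ext_tensor3_null[of scale])
    show "apply_left d (d h) - apply_right d (d h) \<in> tensor3_null scale"
      by (rule coassoc) (simp add: d_def some_comult)
  qed (use assms in \<open>simp_all add: f_def\<close>)
  then have "lin_ext s' f (apply_left d (d h)) = lin_ext s' f (apply_right d (d h))"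
    by (simp add: W.lin_ext_diff)
  then show ?thesis
    unfolding apply_left_def apply_right_def free.linear_of_lin_ext[OF W.linear_lin_ext]
      case_prod_unfold sweedler_def d_def[symmetric]
    by (simp add: f_def case_prod_unfold)
qed

text \<open>The sum is h1 S(h4) \<otimes> h2 S(h3) under \<open>B\<close>. After regrouping, the
  inner product h2 S(h3) collapses to a counit, and what remains is h1 S(h2) \<otimes> 1.\<close>

lemma sweedler_convolution_inverse:
  assumes "bilinear (*) (B :: 'h \<Rightarrow> 'h \<Rightarrow> 'k)"
  shows "sweedler (*) h (\<lambda>y c. sweedler (*) y (\<lambda>p q. sweedler (*) c (\<lambda>u v. B (p * S v) (q * S u)))) =
    \<epsilon> h * B 1 1"
proof -
  note lin = vector_space_field linear_intros bilinearI bilinear_linear_left[OF assms]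
    bilinear_linear_right[OF assms]
  have inner: "sweedler (*) z (\<lambda>q y. sweedler (*) y (\<lambda>u v. B (p * S v) (q * S u))) = B (p * S z) 1"
    for p z
  proof -
    have "sweedler (*) z (\<lambda>q y. sweedler (*) y (\<lambda>u v. B (p * S v) (q * S u))) =
        sweedler (*) z (\<lambda>w v. sweedler (*) w (\<lambda>q u. B (p * S v) (q * S u)))"
      by (rule sweedler_coassoc[symmetric]) (intro lin)+
    also have "\<dots> = sweedler (*) z (\<lambda>w v. \<epsilon> w * B (p * S v) 1)"
      by (subst sweedler_antipode_right) (intro lin refl)+
    also have "\<dots> = B (p * S z) 1"
      by (rule sweedler_counit_left) (intro lin)
    finally show ?thesis .
  qed
  have "sweedler (*) h (\<lambda>y c. sweedler (*) y (\<lambda>p q. sweedler (*) c (\<lambda>u v. B (p * S v) (q * S u)))) =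
      sweedler (*) h (\<lambda>p z. sweedler (*) z (\<lambda>q y. sweedler (*) y (\<lambda>u v. B (p * S v) (q * S u))))"
    by (rule sweedler_coassoc) (intro lin)+
  also have "\<dots> = sweedler (*) h (\<lambda>p z. B (p * S z) 1)"
    by (simp only: inner)
  also have "\<dots> = \<epsilon> h * B 1 1"
    by (rule sweedler_antipode_right) (intro lin)
  finally show ?thesis .
qed

text \<open>Both $\Delta \circ S$ and $(S \otimes S) \circ \tau \circ \Delta$ are convolution inverse to
  $\Delta$, on the left and on the right respectively.\<close>

lemma sweedler_antipode:
  assumes "bilinear (*) (B :: 'h \<Rightarrow> 'h \<Rightarrow> 'k)"
  shows "sweedler (*) (S h) B = sweedler (*) h (\<lambda>a b. B (S b) (S a))"
proof -
  note lin = vector_space_field linear_intros bilinearI bilinear_linear_left[OF assms]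
    bilinear_linear_right[OF assms]
  \<comment> \<open>\<open>F x y c\<close> is the product of \<Delta>(S x), \<Delta>(y) and (S
    \<otimes> S)(\<tau>(\<Delta> c)), where \<tau> is the flip, evaluated by \<open>B\<close>.
    Collapsing \<open>x\<close> with \<open>y\<close>, or \<open>y\<close> with \<open>c\<close>,
    leaves one or the other of the two inverses.\<close>
  define F where "F x y c = sweedler (*) (S x) (\<lambda>p q. sweedler (*) y (\<lambda>p' q'.
      sweedler (*) c (\<lambda>u v. B (p * (p' * S v)) (q * (q' * S u)))))" for x y c
  have left: "sweedler (*) a (\<lambda>x y. F x y c) = \<epsilon> a * sweedler (*) c (\<lambda>u v. B (S v) (S u))" for a c
  proof -
    have C: "bilinear (*) (\<lambda>p q. sweedler (*) c (\<lambda>u v. B (p * S v) (q * S u)))"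
      by (intro lin)
    have "sweedler (*) a (\<lambda>x y. F x y c) =
        sweedler (*) a (\<lambda>x y. sweedler (*) (S x * y) (\<lambda>p q. sweedler (*) c (\<lambda>u v. B (p * S v) (q * S u))))"
      by (simp only: sweedler_mult[OF C] F_def mult.assoc)
    also have "\<dots> = \<epsilon> a * sweedler (*) 1 (\<lambda>p q. sweedler (*) c (\<lambda>u v. B (p * S v) (q * S u)))"
      by (rule sweedler_antipode_left) (rule linear_sweedler_arg[OF C linear_ident])
    finally show ?thesis by (simp add: sweedler_one[OF C])
  qed
  have right: "sweedler (*) b (\<lambda>y c. F a y c) = \<epsilon> b * sweedler (*) (S a) B" for a b
  proof -
    have "sweedler (*) b (\<lambda>y c. F a y c) = sweedler (*) (S a) (\<lambda>p q. sweedler (*) b (\<lambda>y c.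
        sweedler (*) y (\<lambda>p' q'. sweedler (*) c (\<lambda>u v. B (p * (p' * S v)) (q * (q' * S u))))))"
      unfolding F_def by (rule sweedler_swap[OF vector_space_field])
    also have "\<dots> = sweedler (*) (S a) (\<lambda>p q. \<epsilon> b * B p q)"
      by (subst sweedler_convolution_inverse[where B = "\<lambda>r s. B (p * r) (q * s)" for p q])
         (intro lin, simp)
    also have "\<dots> = \<epsilon> b * sweedler (*) (S a) B"
      by (rule sweedler_scale[OF vector_space_field])
    finally show ?thesis .
  qed
  have "sweedler (*) h (\<lambda>a b. B (S b) (S a)) =
      sweedler (*) h (\<lambda>a c. \<epsilon> a * sweedler (*) c (\<lambda>u v. B (S v) (S u)))"
    by (rule sweedler_counit_left[symmetric]) (intro lin)
  also have "\<dots> = sweedler (*) h (\<lambda>a c. sweedler (*) a (\<lambda>x y. F x y c))"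
    by (simp only: left)
  also have "\<dots> = sweedler (*) h (\<lambda>a b. sweedler (*) b (\<lambda>y c. F a y c))"
    unfolding F_def by (rule sweedler_coassoc) (intro lin)+
  also have "\<dots> = sweedler (*) h (\<lambda>a b. \<epsilon> b * sweedler (*) (S a) B)"
    by (simp only: right)
  also have "\<dots> = sweedler (*) (S h) B"
    by (rule sweedler_counit_right) (intro lin)
  finally show ?thesis ..
qed

text \<open>The working criterion for computing a coproduct: it suffices to test the candidate
  expression against all scalar bilinear forms.\<close>

lemma in_comultI:
  assumes "\<And>B. bilinear (*) B \<Longrightarrow>
    lin_ext (*) (\<lambda>(a, b). B a b) t = (sweedler (*) h B :: 'k)"
  shows "t \<in> \<Delta> h"
proof -
  have "t - (SOME t. t \<in> \<Delta> h) \<in> tensor2_null scale"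
    unfolding in_tensor2_null_iff vector_space.lin_ext_diff[OF vector_space_field]
    using assms by (simp add: sweedler_def)
  then show ?thesis using in_comult_iff[OF some_comult] by blast
qed

lemma comult_antipode:
  assumes "t \<in> \<Delta> h"
  shows "lin_ext free_scale (\<lambda>(a, b). Poly_Mapping.single (S b, S a) 1) t \<in> \<Delta> (S h)"
proof (rule in_comultI)
  fix B :: "'h \<Rightarrow> 'h \<Rightarrow> 'k" assume B: "bilinear (*) B"
  have B': "bilinear (*) (\<lambda>a b. B (S b) (S a))"
    by (intro bilinearI bilinear_linear_left[OF B] bilinear_linear_right[OF B] antipode_linear)
  have "lin_ext (*) (\<lambda>(a, b). B a b)
      (lin_ext free_scale (\<lambda>(a, b). Poly_Mapping.single (S b, S a) 1) t) =
      lin_ext (*) (\<lambda>(a, b). B (S b) (S a)) t"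
    unfolding free.linear_of_lin_ext[OF vector_space.linear_lin_ext[OF vector_space_field]]
      case_prod_unfold by (simp add: vector_space.lin_ext_single[OF vector_space_field])
  then show "lin_ext (*) (\<lambda>(a, b). B a b)
      (lin_ext free_scale (\<lambda>(a, b). Poly_Mapping.single (S b, S a) 1) t) = sweedler (*) (S h) B"
    by (simp add: lin_ext_comult[OF B' assms] sweedler_antipode[OF B])
qed

end

section \<open>Group-like and skew-primitive elements\<close>

lemma tensor2_mult_single:
  "tensor2_mult (Poly_Mapping.single p c) (Poly_Mapping.single q d) =
    Poly_Mapping.single (fst p * fst q, snd p * snd q) (c * d)"
  by (simp add: tensor2_mult_lin_ext mult.commute)

lemma tensor2_mult_add_right: "tensor2_mult t (u + v) = tensor2_mult t u + tensor2_mult t v"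
  by (simp add: tensor2_mult_lin_ext free.lin_ext_add)
     (simp add: lin_ext_def free.scale_right_distrib sum.distrib)

lemma power_eq_1_of_mult_eq_1:
  fixes a b :: "'a::monoid_mult"
  assumes "a * b = 1"
  shows "a ^ n * b ^ n = 1"
proof (induction n)
  case (Suc n)
  have "a ^ Suc n * b ^ Suc n = a ^ n * (a * b) * b ^ n"
    by (simp only: power_Suc2[of a] power_Suc[of b] mult.assoc)
  with Suc assms show ?case by simp
qed simp

lemma power_mult_intertwine:
  fixes a b c :: "'a::monoid_mult"
  assumes "a * b = b * c"
  shows "a ^ n * b = b * c ^ n"
proof (induction n)
  case (Suc n)
  have "a ^ Suc n * b = a ^ n * (a * b)" by (simp only: power_Suc2 mult.assoc)
  also have "\<dots> = a ^ n * b * c" by (simp only: assms mult.assoc)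
  also have "\<dots> = b * c ^ Suc n" by (simp only: Suc.IH power_Suc2 mult.assoc)
  finally show ?case .
qed simp

text \<open>The map f \<otimes> f on expressions instead of classes, so that the support of a
  representative can be followed.\<close>

definition tensor2_map :: "('v \<Rightarrow> 'v) \<Rightarrow> ('v \<times> 'v \<Rightarrow>\<^sub>0 'k) \<Rightarrow> ('v \<times> 'v \<Rightarrow>\<^sub>0 'k::field)" where
  "tensor2_map f = lin_ext free_scale (\<lambda>(a, b). Poly_Mapping.single (f a, f b) 1)"

lemma tensor2_map_id: "tensor2_map id = id"
  by (simp add: fun_eq_iff tensor2_map_def case_prod_unfold lin_ext_single_id)

lemma tensor2_map_eq:
  assumes "\<And>a b. (a, b) \<in> Poly_Mapping.keys t \<Longrightarrow> f a = a \<and> f b = b"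
  shows "tensor2_map f t = t"
proof -
  have "tensor2_map f t = lin_ext free_scale (\<lambda>p. Poly_Mapping.single p 1) t"
    unfolding tensor2_map_def using assms by (intro free.lin_ext_cong) auto
  then show ?thesis by (simp only: lin_ext_single_id)
qed

lemma keys_tensor2_map: "Poly_Mapping.keys (tensor2_map f t) \<subseteq> map_prod f f ` Poly_Mapping.keys t"
  unfolding tensor2_map_def using keys_lin_ext_free_scale[of _ t]
  by (rule order_trans) auto

section \<open>Even powers of the antipode on group-likes and skew-primitives\<close>

context hopf_algebra
begin

lemma sweedler_linear:
  "Vector_Spaces.linear s' s'' f \<Longrightarrow> f (sweedler s' h F) = sweedler s'' h (\<lambda>a b. f (F a b))"
  using vector_space.linear_of_lin_ext[OF linear_imp_vector_space(1)]
  by (fastforce simp: sweedler_def case_prod_unfold)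

text \<open>Each application of S exchanges the two tensor factors, and the two exchanges
  cancel.\<close>

lemma comult_square_antipode:
  assumes "t \<in> \<Delta> h"
  shows "tensor2_map (S \<circ> S) t \<in> \<Delta> (S (S h))"
  using comult_antipode[OF comult_antipode[OF assms]]
  unfolding tensor2_map_def free.linear_of_lin_ext[OF free.linear_lin_ext] case_prod_unfold
  by simp

lemma comult_even_power_antipode:
  assumes "t \<in> \<Delta> h"
  shows "tensor2_map ((S \<circ> S) ^^ n) t \<in> \<Delta> (((S \<circ> S) ^^ n) h)"
proof (induction n)
  case 0
  then show ?case using assms by (simp add: tensor2_map_id flip: id_def)
next
  case (Suc n)
  have "tensor2_map (S \<circ> S) (tensor2_map ((S \<circ> S) ^^ n) t) = tensor2_map ((S \<circ> S) ^^ Suc n) t"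
    unfolding tensor2_map_def free.linear_of_lin_ext[OF free.linear_lin_ext] case_prod_unfold
    by simp
  moreover have "((S \<circ> S) ^^ Suc n) h = S (S (((S \<circ> S) ^^ n) h))" by simp
  ultimately show ?case using comult_square_antipode[OF Suc.IH] by metis
qed

lemma linear_even_power_antipode: "Vector_Spaces.linear scale scale ((S \<circ> S) ^^ n)"
proof (induction n)
  case 0
  then show ?case by (simp add: Vector_Spaces.linear_iff vector_space_scale)
next
  case (Suc n)
  then show ?case by (simp add: Vector_Spaces.linear_iff S.add S.scale)
qed

lemma counit_group_like: "g \<in> group_likes \<Longrightarrow> \<epsilon> g = 1"
  using counit_left[of "Poly_Mapping.single (g, g) 1" g] scale_cancel_right[of "\<epsilon> g" g 1]
  by (simp add: group_likes_def)

lemma one_group_like: "1 \<in> group_likes"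
  by (simp add: group_likes_def comult_one)

lemma mult_group_like:
  assumes "g \<in> group_likes" "h \<in> group_likes"
  shows "g * h \<in> group_likes"
proof -
  have "Poly_Mapping.single (g * h, g * h) 1 \<in> \<Delta> (g * h)"
    using comult_mult[of "Poly_Mapping.single (g, g) 1" g "Poly_Mapping.single (h, h) 1" h] assms
    by (simp add: group_likes_def tensor2_mult_single)
  \<comment> \<open>H may have zero divisors; the multiplicative counit shows that the product does
    not vanish.\<close>
  moreover have "\<epsilon> (g * h) = 1" using assms by (simp add: counit_mult counit_group_like)
  then have "g * h \<noteq> 0" using \<epsilon>.zero by force
  ultimately show ?thesis by (simp add: group_likes_def)
qed

lemma antipode_group_like_left: "g \<in> group_likes \<Longrightarrow> S g * g = 1"
  using antipode_left[of "Poly_Mapping.single (g, g) 1" g]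
  by (simp add: counit_group_like) (simp add: group_likes_def)

lemma antipode_group_like_right: "g \<in> group_likes \<Longrightarrow> g * S g = 1"
  using antipode_right[of "Poly_Mapping.single (g, g) 1" g]
  by (simp add: counit_group_like) (simp add: group_likes_def)

lemma antipode_group_like:
  assumes "g \<in> group_likes"
  shows "S g \<in> group_likes"
proof -
  have "Poly_Mapping.single (S g, S g) 1 \<in> \<Delta> (S g)"
    using comult_antipode[of "Poly_Mapping.single (g, g) 1" g] assms
    by (simp add: group_likes_def)
  moreover have "S g \<noteq> 0"
    using antipode_group_like_left[OF assms] by force
  ultimately show ?thesis by (simp add: group_likes_def)
qed

lemma square_antipode_group_like:
  assumes "g \<in> group_likes"
  shows "S (S g) = g"
proof -
  have "S (S g) = S (S g) * (S g * g)" by (simp add: antipode_group_like_left assms)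
  also have "\<dots> = S (S g) * S g * g" by (simp only: mult.assoc)
  also have "\<dots> = g" by (simp add: antipode_group_like_left antipode_group_like assms)
  finally show ?thesis .
qed

lemma even_power_antipode_group_like: "g \<in> group_likes \<Longrightarrow> ((S \<circ> S) ^^ n) g = g"
  by (induction n) (simp_all add: square_antipode_group_like)

text \<open>Both group-likes are free, because the pieces of H(1) belong to arbitrary pairs; only a
  left translation brings them into some \<open>skew_primitives x\<close>.\<close>

definition skew_primitive :: "'h \<Rightarrow> 'h \<Rightarrow> 'h \<Rightarrow> bool" where
  "skew_primitive g g' m \<longleftrightarrow> Poly_Mapping.single (m, g') 1 + Poly_Mapping.single (g, m) 1 \<in> \<Delta> m"

lemma skew_primitives_iff: "m \<in> skew_primitives x \<longleftrightarrow> skew_primitive 1 x m"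
  by (simp add: skew_primitives_def skew_primitive_def)

text \<open>The counit axiom gives \<epsilon>(m) g' = 0, hence \<epsilon>(m) = 0, and then the
  antipode axiom reads S(m) g' + S(g) m = 0. The second claim is the reversed coproduct.\<close>

lemma antipode_skew_primitive:
  assumes "g \<in> group_likes" "g' \<in> group_likes" "skew_primitive g g' m"
  shows "S m = - (S g * m * S g')" "skew_primitive (S g') (S g) (S m)"
proof -
  have m: "Poly_Mapping.single (m, g') 1 + Poly_Mapping.single (g, m) 1 \<in> \<Delta> m"
    using assms(3) by (simp add: skew_primitive_def)
  have "\<epsilon> m *s g' + \<epsilon> g *s m = m"
    using counit_left[OF m] by (simp add: lin_ext_add)
  then have "\<epsilon> m *s g' = 0" using assms(1) by (simp add: counit_group_like)
  then have "\<epsilon> m = 0" using assms(2) by (auto simp: group_likes_def)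
  then have "S m * g' = - (S g * m)"
    using antipode_left[OF m] by (simp add: lin_ext_add eq_neg_iff_add_eq_0)
  moreover have "S m = S m * g' * S g'"
    using assms(2) by (simp add: mult.assoc antipode_group_like_right)
  ultimately show "S m = - (S g * m * S g')" by simp
  show "skew_primitive (S g') (S g) (S m)"
    using comult_antipode[OF m] by (simp add: skew_primitive_def free.lin_ext_add add.commute)
qed

text \<open>The pair (g, g') becomes (S g', S g) and then returns to itself, so the formula for S
  applies twice and its square can be iterated.\<close>

lemma square_antipode_skew_primitive:
  assumes "g \<in> group_likes" "g' \<in> group_likes" "skew_primitive g g' m"
  shows "S (S m) = g' * S g * m * (S g' * g)" "skew_primitive g g' (S (S m))"
  using antipode_skew_primitive[OF assms]
    antipode_skew_primitive[OF antipode_group_like antipode_group_like, of g' g "S m"] assms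
  by (simp_all add: square_antipode_group_like mult.assoc)

lemma even_power_antipode_skew_primitive:
  assumes "g \<in> group_likes" "g' \<in> group_likes" "skew_primitive g g' m"
  shows "((S \<circ> S) ^^ n) m = (g' * S g) ^ n * m * (S g' * g) ^ n"
  using assms(3)
proof (induction n arbitrary: m)
  case (Suc n)
  note sq = square_antipode_skew_primitive[OF assms(1,2) Suc.prems]
  have "((S \<circ> S) ^^ Suc n) m = ((S \<circ> S) ^^ n) (S (S m))"
    by (simp add: funpow_swap1)
  also have "\<dots> = (g' * S g) ^ n * S (S m) * (S g' * g) ^ n"
    by (rule Suc.IH[OF sq(2)])
  also have "\<dots> = (g' * S g) ^ Suc n * m * (S g' * g) ^ Suc n"
    unfolding sq(1) power_Suc2[of "g' * S g"] power_Suc[of "S g' * g"] by (simp only: mult.assoc)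
  finally show ?case .
qed simp

text \<open>\<open>S g\<close> is the group-like inverse of \<open>g\<close>; multiplying by its
  coproduct turns the left factor \<open>g\<close> into 1.\<close>

lemma skew_primitive_translate:
  assumes "g \<in> group_likes" "skew_primitive g g' m"
  shows "S g * m \<in> skew_primitives (S g * g')"
proof -
  have "Poly_Mapping.single (S g, S g) 1 \<in> \<Delta> (S g)"
    using antipode_group_like[OF assms(1)] by (simp add: group_likes_def)
  from comult_mult[OF this assms(2)[unfolded skew_primitive_def]] show ?thesis
    by (simp add: skew_primitives_def tensor2_mult_add_right tensor2_mult_single
        antipode_group_like_left assms(1))
qed

lemma even_power_antipode_fixes_iff:
  assumes "x \<in> group_likes" "p \<in> skew_primitives x"
  shows "((S \<circ> S) ^^ n) p = p \<longleftrightarrow> x ^ n * p = p * x ^ n"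
proof -
  have S1: "S 1 = 1" using antipode_group_like_left[OF one_group_like] by simp
  have eq: "((S \<circ> S) ^^ n) p = x ^ n * p * S x ^ n"
    using even_power_antipode_skew_primitive[OF one_group_like assms(1), of p n] assms(2)
    by (simp add: skew_primitives_iff S1)
  have inv: "x ^ n * S x ^ n = 1" "S x ^ n * x ^ n = 1"
    using assms(1) by (simp_all add: power_eq_1_of_mult_eq_1 antipode_group_like_left
        antipode_group_like_right)
  show ?thesis
  proof
    assume "((S \<circ> S) ^^ n) p = p"
    then have "p * x ^ n = x ^ n * p * (S x ^ n * x ^ n)" by (simp add: eq flip: mult.assoc)
    then show "x ^ n * p = p * x ^ n" by (simp add: inv)
  next
    assume "x ^ n * p = p * x ^ n"
    then show "((S \<circ> S) ^^ n) p = p" by (simp add: eq inv mult.assoc)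
  qed
qed

text \<open>Write m = g y with y skew-primitive for x = g^-1 g'. The power of S multiplies by (g'
  g^-1)^n on the left and by (g'^-1 g)^n on the right; moved past g, the left factor becomes x^n,
  which commutes with y and cancels the right one.\<close>

lemma even_power_antipode_fixes_skew_primitive:
  assumes "\<And>x p. x \<in> group_likes \<Longrightarrow> p \<in> skew_primitives x \<Longrightarrow> x ^ n * p = p * x ^ n"
    and "g \<in> group_likes" "g' \<in> group_likes" "skew_primitive g g' m"
  shows "((S \<circ> S) ^^ n) m = m"
proof -
  define x y where "x = S g * g'" and "y = S g * m"
  have x: "x \<in> group_likes" unfolding x_def by (intro mult_group_like antipode_group_like assms)
  have xy: "x ^ n * y = y * x ^ n"
    using skew_primitive_translate[OF assms(2,4)] by (intro assms(1) x) (simp add: x_def y_def)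
  have m: "m = g * y"
    using assms(2) by (simp add: y_def antipode_group_like_right flip: mult.assoc)
  \<comment> \<open>Conjugation by g carries g' g^-1 to g^-1 g' = x; both sides equal g'.\<close>
  have "g' * S g * g = g * x"
    using assms(2) by (simp add: x_def mult.assoc antipode_group_like_left)
      (simp add: antipode_group_like_right flip: mult.assoc)
  then have ug: "(g' * S g) ^ n * g = g * x ^ n" by (rule power_mult_intertwine)
  \<comment> \<open>The right-hand multiplier g'^-1 g is the inverse of x.\<close>
  have "x * (S g' * g) = S g * (g' * S g') * g" by (simp add: x_def mult.assoc)
  then have "x * (S g' * g) = 1"
    using assms(2,3) by (simp add: antipode_group_like_left antipode_group_like_right)
  then have xv: "x ^ n * (S g' * g) ^ n = 1" by (rule power_eq_1_of_mult_eq_1)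
  have "((S \<circ> S) ^^ n) m = ((g' * S g) ^ n * g) * y * (S g' * g) ^ n"
    unfolding even_power_antipode_skew_primitive[OF assms(2-4)] by (simp add: m mult.assoc)
  also have "\<dots> = g * (x ^ n * y) * (S g' * g) ^ n"
    unfolding ug by (simp only: mult.assoc)
  also have "\<dots> = g * y * (x ^ n * (S g' * g) ^ n)"
    unfolding xy by (simp only: mult.assoc)
  finally show ?thesis by (simp add: xv m)
qed

text \<open>Contract the coproduct with the coordinate functional f of a basis vector b that occurs
  in g. The resulting linear map sends every group-like x to f(x) x, while on the basis it agrees
  with x \<mapsto> f(x) b; at g this gives g = b.\<close>

lemma independent_group_likes: "independent group_likes"
proof -
  obtain B where B: "B \<subseteq> group_likes" "independent B" "group_likes \<subseteq> span B"
    using maximal_independent_subset[of group_likes] by blast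
  have "g \<in> B" if g: "g \<in> group_likes" for g
  proof -
    have "g \<noteq> 0" "g \<in> span B" using g B by (auto simp: group_likes_def)
    then obtain b where b: "representation B g b \<noteq> 0"
      using sum_nonzero_representation_eq[OF B(2), of g] by (metis (mono_tags, lifting) empty_Collect_eq sum.empty)
    then have "b \<in> B" using representation_ne_zero by blast
    interpret forms: vector_space_pair scale "(*) :: 'k \<Rightarrow> 'k \<Rightarrow> 'k"
      using vector_space_scale vector_space_field by (rule vector_space_pair.intro)
    obtain f where f: "Vector_Spaces.linear scale (*) f" "\<forall>x\<in>B. f x = (if x = b then 1 else 0)"
      using forms.linear_independent_extend[OF B(2), of "\<lambda>x. if x = b then 1 else 0"] by blast
    interpret f: Vector_Spaces.linear scale "(*)" f by (rule f)
    have bil: "bilinear scale (\<lambda>x y. f x *s y)"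
      by (intro bilinearI)
        (simp_all add: Vector_Spaces.linear_iff vector_space_scale f.add f.scale scale_left_distrib
          scale_right_distrib mult.commute)
    have sw: "sweedler scale x (\<lambda>x y. f x *s y) = f x *s x" if "x \<in> group_likes" for x
      using lin_ext_comult[OF bil, of "Poly_Mapping.single (x, x) 1" x] that
      by (simp add: group_likes_def)
    \<comment> \<open>The difference of the two linear maps vanishes on \<open>B\<close>, where
      \<open>f\<close> is nonzero only at \<open>b\<close>, and so on the span, which contains
      \<open>g\<close>.\<close>
    let ?D = "\<lambda>x. sweedler scale x (\<lambda>x y. f x *s y) - f x *s b"
    have "Vector_Spaces.linear scale scale ?D"
      using linear_sweedler_arg[OF bil linear_ident]
      by (simp add: Vector_Spaces.linear_iff f.add f.scale scale_left_distrib
          scale_right_diff_distrib)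
    moreover have "?D x = 0" if "x \<in> B" for x
      using that B(1) sw[of x] f(2) by auto
    ultimately have "?D g = 0"
      using \<open>g \<in> span B\<close> by (rule module_hom.eq_0_on_span[OF Vector_Spaces.linear.axioms(3)])
    then have "f g *s g = f g *s b" using sw[OF g] by simp
    moreover have "f g = representation B g b"
    proof -
      let ?r = "representation B g"
      have "f g = f (\<Sum>c | ?r c \<noteq> 0. ?r c *s c)"
        by (simp add: sum_nonzero_representation_eq[OF B(2) \<open>g \<in> span B\<close>])
      also have "\<dots> = (\<Sum>c | ?r c \<noteq> 0. if c = b then ?r b else 0)"
        unfolding f.sum f.scale using f(2) representation_ne_zero
        by (intro sum.cong) auto
      also have "\<dots> = ?r b"
        using b by (simp add: finite_representation)
      finally show ?thesis .
    qed
    ultimately show "g \<in> B" using b \<open>b \<in> B\<close> by simp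
  qed
  then have "group_likes = B" using B(1) by blast
  with B(2) show ?thesis by simp
qed

end

section \<open>Pointed coradically graded Hopf algebras\<close>

locale pointed_coradically_graded_hopf_algebra = hopf_algebra scale \<Delta> \<epsilon> S
  for scale :: "'k::field \<Rightarrow> 'h::ring_1 \<Rightarrow> 'h" (infixr \<open>*s\<close> 75)
    and \<Delta> :: "'h \<Rightarrow> ('h \<times> 'h \<Rightarrow>\<^sub>0 'k) set"
    and \<epsilon> :: "'h \<Rightarrow> 'k"
    and S :: "'h \<Rightarrow> 'h" +
  fixes gr :: "nat \<Rightarrow> 'h set"
  assumes pointed: pointed
    and coradical_grading: "coradical_grading gr"
begin

lemma hopf_grading: "hopf_grading gr"
  and filtration_eq: "coradical_filtration n = {\<Sum>i\<le>n. f i | f. \<forall>i\<le>n. f i \<in> gr i}"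
  using coradical_grading unfolding coradical_grading_def by (blast, simp only:)

lemma coalgebra_grading: "coalgebra_grading gr"
  using hopf_grading by (simp only: hopf_grading_def)

lemma direct_sum: "direct_sum_decomposition gr"
  using coalgebra_grading by (simp only: coalgebra_grading_def)

lemma gr_comult: "h \<in> gr n \<Longrightarrow>
    \<exists>t. (\<forall>i\<le>n. t i \<in> tensors_from (gr i) (gr (n - i))) \<and> (\<Sum>i\<le>n. t i) \<in> \<Delta> h"
  using coalgebra_grading by (simp only: coalgebra_grading_def)

lemma gr_antipode: "h \<in> gr n \<Longrightarrow> S h \<in> gr n"
  using hopf_grading by (auto simp only: hopf_grading_def image_subset_iff)

lemma gr_counit: "h \<in> gr n \<Longrightarrow> n \<ge> 1 \<Longrightarrow> \<epsilon> h = 0"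
  using coalgebra_grading by (simp only: coalgebra_grading_def)

lemma subspace_gr: "subspace (gr n)"
  using direct_sum by (simp add: direct_sum_decomposition_def)

lemma gr_0_eq: "gr 0 = span group_likes" and coradical_eq: "coradical = gr 0"
proof -
  have "coradical = {\<Sum>i\<le>0. f i | f. \<forall>i\<le>0. f i \<in> gr i}"
    using filtration_eq[of 0] by simp
  also have "\<dots> = gr 0" by auto
  finally show "coradical = gr 0" .
  with pointed show "gr 0 = span group_likes" by (simp add: pointed_def)
qed

section \<open>Homogeneous projections and the coefficient functionals of the group-likes\<close>

definition total :: "(nat \<Rightarrow>\<^sub>0 'h) \<Rightarrow> 'h" where
  "total f = (\<Sum>n\<in>Poly_Mapping.keys f. Poly_Mapping.lookup f n)"

definition component :: "nat \<Rightarrow> 'h \<Rightarrow> 'h" where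
  "component n h = Poly_Mapping.lookup
     (THE f. (\<forall>n. Poly_Mapping.lookup f n \<in> gr n) \<and> h = total f) n"

lemma total_superset:
  "finite A \<Longrightarrow> Poly_Mapping.keys f \<subseteq> A \<Longrightarrow> total f = (\<Sum>n\<in>A. Poly_Mapping.lookup f n)"
  unfolding total_def by (rule sum.mono_neutral_left) (auto simp: in_keys_iff)

lemma component_total:
  assumes "\<And>n. Poly_Mapping.lookup f n \<in> gr n"
  shows "component n (total f) = Poly_Mapping.lookup f n"
proof -
  have "\<exists>!f'. (\<forall>n. Poly_Mapping.lookup f' n \<in> gr n) \<and> total f = total f'"
    using direct_sum unfolding direct_sum_decomposition_def total_def by blast
  then have "(THE f'. (\<forall>n. Poly_Mapping.lookup f' n \<in> gr n) \<and> total f = total f') = f"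
    by (rule the1_equality) (simp add: assms)
  then show ?thesis by (simp add: component_def)
qed

lemma decompose:
  obtains f where "\<And>n. Poly_Mapping.lookup f n \<in> gr n" "h = total f"
  using direct_sum unfolding direct_sum_decomposition_def total_def by blast

lemma linear_component: "Vector_Spaces.linear scale scale (component n)"
  unfolding Vector_Spaces.linear_iff
proof (intro conjI allI vector_space_scale)
  fix h k
  obtain f g where f: "\<And>n. Poly_Mapping.lookup f n \<in> gr n" "h = total f"
    and g: "\<And>n. Poly_Mapping.lookup g n \<in> gr n" "k = total g"
    using decompose[of h] decompose[of k] by metis
  let ?A = "Poly_Mapping.keys f \<union> Poly_Mapping.keys g"
  have "h + k = total (f + g)"
    using Poly_Mapping.keys_add[of f g] unfolding f(2) g(2)
    by (simp add: total_superset[of ?A] lookup_add sum.distrib)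
  then show "component n (h + k) = component n h + component n k"
    using f g by (simp add: component_total lookup_add subspace_add subspace_gr)
next
  fix c h
  obtain f where f: "\<And>n. Poly_Mapping.lookup f n \<in> gr n" "h = total f"
    using decompose[of h] by metis
  have lk: "Poly_Mapping.lookup (Poly_Mapping.map (scale c) f) n = scale c (Poly_Mapping.lookup f n)" for n
    by (simp add: Poly_Mapping.map.rep_eq when_def)
  then have "Poly_Mapping.keys (Poly_Mapping.map (scale c) f) \<subseteq> Poly_Mapping.keys f"
    by (auto simp: in_keys_iff)
  then have "scale c h = total (Poly_Mapping.map (scale c) f)"
    unfolding f(2) by (simp add: total_superset[of "Poly_Mapping.keys f"] lk scale_sum_right)
  then show "component n (scale c h) = scale c (component n h)"
    using f by (simp add: component_total lk subspace_scale subspace_gr)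
qed

sublocale component: Vector_Spaces.linear scale scale "component n" for n
  by (rule linear_component)

lemma component_gr:
  assumes "h \<in> gr m"
  shows "component n h = (if n = m then h else 0)"
proof -
  have "Poly_Mapping.lookup (Poly_Mapping.single m h) i \<in> gr i" for i
    using assms by (auto simp: lookup_single when_def subspace_0[OF subspace_gr])
  from component_total[of _ n, OF this]
  have "component n (total (Poly_Mapping.single m h)) = (if n = m then h else 0)"
    by (simp add: lookup_single when_def)
  moreover have "total (Poly_Mapping.single m h) = h"
    by (simp add: total_superset[of "{m}"])
  ultimately show ?thesis by simp
qed

lemma span_gr: "span (\<Union>n. gr n) = UNIV"
proof -
  have "h \<in> span (\<Union>n. gr n)" for h
  proof -
    obtain f where f: "\<And>n. Poly_Mapping.lookup f n \<in> gr n" "h = total f"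
      using decompose[of h] by metis
    then show ?thesis unfolding f(2) total_def by (intro span_sum span_base) blast
  qed
  then show ?thesis by blast
qed

lemma linear_eq_gr:
  assumes "Vector_Spaces.linear scale s' f" "Vector_Spaces.linear scale s' f'"
    and "\<And>n h. h \<in> gr n \<Longrightarrow> f h = f' h"
  shows "f h = f' h"
proof -
  interpret vector_space_pair scale s'
    using linear_imp_vector_space[OF assms(1)] by (rule vector_space_pair.intro)
  show ?thesis
    by (rule linear_eq_on[OF assms(1,2), of h "\<Union>n. gr n"]) (auto simp: span_gr assms(3))
qed

lemma linear_eq_gr_0:
  assumes "Vector_Spaces.linear scale s' f" "Vector_Spaces.linear scale s' f'"
    and "\<And>g. g \<in> group_likes \<Longrightarrow> f g = f' g" and "h \<in> gr 0"
  shows "f h = f' h"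
proof -
  interpret vector_space_pair scale s'
    using linear_imp_vector_space[OF assms(1)] by (rule vector_space_pair.intro)
  show ?thesis
    by (rule linear_eq_on[OF assms(1,2), of h group_likes]) (use assms(3,4) gr_0_eq in auto)
qed

text \<open>The functional dual to the basis of group-likes of H(0), extended by zero to the
  positive degrees so that it can be applied to any tensor factor.\<close>

definition coef :: "'h \<Rightarrow> 'h \<Rightarrow> 'k" where
  "coef g h = representation group_likes (component 0 h) g"

lemma component_0_in_span: "component 0 h \<in> span group_likes"
proof -
  obtain f where f: "\<And>n. Poly_Mapping.lookup f n \<in> gr n" "h = total f"
    using decompose[of h] by metis
  then show ?thesis by (simp add: component_total flip: gr_0_eq)
qed

lemma linear_coef: "Vector_Spaces.linear scale (*) (coef g)"
  unfolding Vector_Spaces.linear_iff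
  by (simp add: vector_space_scale vector_space_field coef_def component.add component.scale
      representation_add representation_scale independent_group_likes component_0_in_span)

sublocale coef: Vector_Spaces.linear scale "(*)" "coef g" for g
  by (rule linear_coef)

lemma group_like_in_gr_0: "g \<in> group_likes \<Longrightarrow> g \<in> gr 0"
  by (simp add: gr_0_eq span_base)

lemma coef_group_like: "h \<in> group_likes \<Longrightarrow> coef g h = (if h = g then 1 else 0)"
  by (simp add: coef_def component_gr[OF group_like_in_gr_0] representation_basis
      independent_group_likes)

lemma coef_gr: "h \<in> gr n \<Longrightarrow> n \<ge> 1 \<Longrightarrow> coef g h = 0"
  by (simp add: coef_def component_gr representation_zero)

lemma finite_coef: "finite {g. coef g h \<noteq> 0}"
  by (simp add: coef_def finite_representation)

lemma coef_nonzero: "coef g h \<noteq> 0 \<Longrightarrow> g \<in> group_likes"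
  unfolding coef_def by (rule representation_ne_zero)

lemma sum_coef:
  assumes "h \<in> gr 0" "finite A" "{g. coef g h \<noteq> 0} \<subseteq> A"
  shows "(\<Sum>g\<in>A. coef g h *s g) = h"
proof -
  have "(\<Sum>g\<in>A. coef g h *s g) = (\<Sum>g | coef g h \<noteq> 0. coef g h *s g)"
    using assms by (intro sum.mono_neutral_right) auto
  also have "\<dots> = h"
    using sum_nonzero_representation_eq[OF independent_group_likes, of h] assms(1)
    by (simp add: coef_def component_gr[OF assms(1)] gr_0_eq)
  finally show ?thesis .
qed

text \<open>The functionals are orthogonal idempotents of the dual algebra. On group-likes this is
  immediate; in degree n \<ge> 1 every term of the coproduct has a factor of positive degree, where
  they vanish.\<close>

lemma coef_convolution:
  "sweedler (*) h (\<lambda>x y. coef g x * coef a y) = (if a = g then coef g h else 0)"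
proof -
  have bil: "bilinear (*) (\<lambda>x y. coef g x * coef a y)"
    by (rule bilinearI)
       (simp_all add: Vector_Spaces.linear_iff vector_space_scale vector_space_field
         coef.add coef.scale distrib_left distrib_right)
  have lin: "Vector_Spaces.linear scale (*) (\<lambda>h. if a = g then coef g h else 0)"
    by (simp add: Vector_Spaces.linear_iff vector_space_scale vector_space_field coef.add coef.scale)
  note sw_lin = linear_sweedler_arg[OF bil linear_ident]
  show ?thesis
  proof (rule linear_eq_gr[OF sw_lin lin])
    fix n h assume h: "h \<in> gr n"
    show "sweedler (*) h (\<lambda>x y. coef g x * coef a y) = (if a = g then coef g h else 0)"
    proof (cases "n = 0")
      case True
      show ?thesis
      proof (rule linear_eq_gr_0[OF sw_lin lin])
        fix x assume x: "x \<in> group_likes"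
        then have "Poly_Mapping.single (x, x) 1 \<in> \<Delta> x" by (simp add: group_likes_def)
        from lin_ext_comult[OF bil this]
        show "sweedler (*) x (\<lambda>x y. coef g x * coef a y) = (if a = g then coef g x else 0)"
          using x by (auto simp: vector_space.lin_ext_single[OF vector_space_field] coef_group_like
              split: if_splits)
      qed (use h True in simp)
    next
      case False
      obtain t where t: "\<And>i. i \<le> n \<Longrightarrow> t i \<in> tensors_from (gr i) (gr (n - i))" "(\<Sum>i\<le>n. t i) \<in> \<Delta> h"
        using gr_comult[OF h] by blast
      have "lin_ext (*) (\<lambda>(x, y). coef g x * coef a y) (t i) = 0" if i: "i \<le> n" for i
      proof (rule vector_space.lin_ext_eq_0[OF vector_space_field])
        fix p assume "p \<in> Poly_Mapping.keys (t i)"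
        then have p: "fst p \<in> gr i" "snd p \<in> gr (n - i)"
          using t(1)[OF i] by (auto simp: tensors_from_def)
        have "i \<ge> 1 \<or> n - i \<ge> 1" using False by arith
        then have "coef g (fst p) = 0 \<or> coef a (snd p) = 0"
          using p coef_gr by blast
        then show "(case p of (x, y) \<Rightarrow> coef g x * coef a y) = 0"
          by (auto simp: case_prod_unfold)
      qed
      then show ?thesis
        using lin_ext_comult[OF bil t(2)] coef_gr[OF h, of g] False
        by (simp add: vector_space.lin_ext_sum[OF vector_space_field])
    qed
  qed
qed

section \<open>The two coactions of H(0), split by the coefficient functionals\<close>

lemma linear_scale_left:
  "Vector_Spaces.linear scale (*) f \<Longrightarrow> Vector_Spaces.linear scale scale (\<lambda>z. scale (f z) v)"
  by (simp add: Vector_Spaces.linear_iff scale_left_distrib)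

lemma linear_scale_right:
  "Vector_Spaces.linear scale scale f \<Longrightarrow> Vector_Spaces.linear scale scale (\<lambda>z. scale c (f z))"
  by (simp add: Vector_Spaces.linear_iff scale_right_distrib mult.commute)

text \<open>The action of \<open>coef g\<close> on H through the first tensor factor; it extracts
  the part of h on which the left H(0)-coaction has coefficient g.\<close>

definition left_part :: "'h \<Rightarrow> 'h \<Rightarrow> 'h" where
  "left_part g h = sweedler scale h (\<lambda>x y. scale (coef g x) y)"

definition right_part :: "'h \<Rightarrow> 'h \<Rightarrow> 'h" where
  "right_part g h = sweedler scale h (\<lambda>x y. scale (coef g y) x)"

lemma bilinear_left_part: "bilinear scale (\<lambda>x y. scale (coef g x) y)"
  by (intro bilinearI linear_scale_left linear_scale_right linear_coef linear_ident)

lemma bilinear_right_part: "bilinear scale (\<lambda>x y. scale (coef g y) x)"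
  by (intro bilinearI linear_scale_left linear_scale_right linear_coef linear_ident)

lemma linear_left_part: "Vector_Spaces.linear scale scale (left_part g)"
  unfolding left_part_def by (rule linear_sweedler_arg[OF bilinear_left_part linear_ident])

lemma linear_right_part: "Vector_Spaces.linear scale scale (right_part g)"
  unfolding right_part_def by (rule linear_sweedler_arg[OF bilinear_right_part linear_ident])

sublocale left_part: Vector_Spaces.linear scale scale "left_part g" for g
  by (rule linear_left_part)

sublocale right_part: Vector_Spaces.linear scale scale "right_part g" for g
  by (rule linear_right_part)

lemma linear_scale_const: "Vector_Spaces.linear (*) scale (\<lambda>c. scale c v)"
  by (simp add: Vector_Spaces.linear_iff vector_space_scale vector_space_field scale_left_distrib)

text \<open>By coassociativity, acting twice is acting once by the convolution product, so
  orthogonal idempotents give orthogonal projections.\<close>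

lemma left_part_left_part: "left_part a (left_part g h) = (if a = g then left_part g h else 0)"
proof -
  have "left_part a (left_part g h) =
      sweedler scale h (\<lambda>x y. sweedler scale y (\<lambda>u v. scale (coef g x) (scale (coef a u) v)))"
    unfolding left_part_def[of g] sweedler_linear[OF linear_left_part] left_part.scale
    unfolding left_part_def sweedler_scale[OF vector_space_scale] ..
  also have "\<dots> = sweedler scale h (\<lambda>w v. sweedler scale w (\<lambda>x u. scale (coef g x) (scale (coef a u) v)))"
    by (rule sweedler_coassoc[symmetric]) (intro linear_scale_left linear_scale_right linear_coef linear_ident)+
  also have "\<dots> = sweedler scale h (\<lambda>w v. scale (if a = g then coef g w else 0) v)"
    unfolding coef_convolution[symmetric] sweedler_linear[OF linear_scale_const]
    by simp
  also have "\<dots> = (if a = g then left_part g h else 0)"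
    by (simp add: left_part_def sweedler_def lin_ext_def case_prod_unfold)
  finally show ?thesis .
qed

lemma right_part_right_part: "right_part a (right_part g h) = (if a = g then right_part g h else 0)"
proof -
  have "right_part a (right_part g h) =
      sweedler scale h (\<lambda>y x. sweedler scale y (\<lambda>v u. scale (coef g x) (scale (coef a u) v)))"
    unfolding right_part_def[of g] sweedler_linear[OF linear_right_part] right_part.scale
    unfolding right_part_def sweedler_scale[OF vector_space_scale] ..
  also have "\<dots> = sweedler scale h (\<lambda>v w. sweedler scale w (\<lambda>u x. scale (coef g x) (scale (coef a u) v)))"
    by (rule sweedler_coassoc) (intro linear_scale_left linear_scale_right linear_coef linear_ident)+
  also have "\<dots> = sweedler scale h (\<lambda>v w. sweedler scale w (\<lambda>u x. scale (coef a u * coef g x) v))"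
    by (simp add: mult.commute)
  also have "\<dots> = sweedler scale h (\<lambda>v w. scale (if g = a then coef a w else 0) v)"
    unfolding coef_convolution[symmetric] sweedler_linear[OF linear_scale_const]
    by simp
  also have "\<dots> = (if a = g then right_part g h else 0)"
    by (simp add: right_part_def sweedler_def lin_ext_def case_prod_unfold)
  finally show ?thesis .
qed

text \<open>The two actions use opposite ends of the iterated coproduct, so coassociativity lets
  them commute.\<close>

lemma left_part_right_part: "left_part a (right_part b h) = right_part b (left_part a h)"
proof -
  have "left_part a (right_part b h) =
      sweedler scale h (\<lambda>x y. sweedler scale x (\<lambda>u v. scale (coef b y) (scale (coef a u) v)))"
    unfolding right_part_def sweedler_linear[OF linear_left_part] left_part.scale
    unfolding left_part_def sweedler_scale[OF vector_space_scale] ..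
  also have "\<dots> = sweedler scale h (\<lambda>u z. sweedler scale z (\<lambda>v y. scale (coef b y) (scale (coef a u) v)))"
    by (rule sweedler_coassoc) (intro linear_scale_left linear_scale_right linear_coef linear_ident)+
  also have "\<dots> = sweedler scale h (\<lambda>u z. sweedler scale z (\<lambda>v y. scale (coef a u) (scale (coef b y) v)))"
    by (simp add: mult.commute)
  also have "\<dots> = right_part b (left_part a h)"
    unfolding left_part_def sweedler_linear[OF linear_right_part] right_part.scale
    unfolding right_part_def sweedler_scale[OF vector_space_scale] ..
  finally show ?thesis .
qed

end

section \<open>Skew-primitives span the component of degree one\<close>

context pointed_coradically_graded_hopf_algebra
begin

text \<open>\<open>representation\<close> is 0 off the basis, so sums over the nonzero parts run
  over group-likes only.\<close>

lemma left_part_nonzero: "left_part g h \<noteq> 0 \<Longrightarrow> g \<in> group_likes"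
proof (rule ccontr)
  assume "g \<notin> group_likes"
  then have "coef g = (\<lambda>x. 0)" using coef_nonzero by blast
  moreover assume "left_part g h \<noteq> 0"
  ultimately show False by (simp add: left_part_def sweedler_def lin_ext_eq_0)
qed

lemma right_part_nonzero: "right_part g h \<noteq> 0 \<Longrightarrow> g \<in> group_likes"
proof (rule ccontr)
  assume "g \<notin> group_likes"
  then have "coef g = (\<lambda>x. 0)" using coef_nonzero by blast
  moreover assume "right_part g h \<noteq> 0"
  ultimately show False by (simp add: right_part_def sweedler_def lin_ext_eq_0)
qed

lemma finite_left_part: "finite {g. left_part g h \<noteq> 0}"
proof (rule finite_subset)
  let ?t = "SOME t. t \<in> \<Delta> h"
  show "{g. left_part g h \<noteq> 0} \<subseteq> (\<Union>p\<in>Poly_Mapping.keys ?t. {g. coef g (fst p) \<noteq> 0})"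
    unfolding left_part_def sweedler_def by (force intro!: lin_ext_eq_0)
  show "finite (\<Union>p\<in>Poly_Mapping.keys ?t. {g. coef g (fst p) \<noteq> 0})"
    by (simp add: finite_coef)
qed

lemma finite_right_part: "finite {g. right_part g h \<noteq> 0}"
proof (rule finite_subset)
  let ?t = "SOME t. t \<in> \<Delta> h"
  show "{g. right_part g h \<noteq> 0} \<subseteq> (\<Union>p\<in>Poly_Mapping.keys ?t. {g. coef g (snd p) \<noteq> 0})"
    unfolding right_part_def sweedler_def by (force intro!: lin_ext_eq_0)
  show "finite (\<Union>p\<in>Poly_Mapping.keys ?t. {g. coef g (snd p) \<noteq> 0})"
    by (simp add: finite_coef)
qed

text \<open>Expand each left factor in the basis of group-likes and collect by bilinearity: t
  becomes a sum of tensors g \<otimes> t_g.\<close>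

lemma lin_ext_gr_0_left:
  assumes B: "bilinear s' B" and t: "t \<in> tensors_from (gr 0) UNIV"
    and A: "finite A" "\<And>p g. p \<in> Poly_Mapping.keys t \<Longrightarrow> coef g (fst p) \<noteq> 0 \<Longrightarrow> g \<in> A"
  shows "lin_ext s' (\<lambda>(a, b). B a b) t =
    (\<Sum>g\<in>A. B g (lin_ext scale (\<lambda>(a, b). scale (coef g a) b) t))"
proof -
  interpret W: vector_space s' using B by (rule bilinear_imp_vector_space)
  have B1: "Vector_Spaces.linear scale s' (\<lambda>a. B a b)" and B2: "Vector_Spaces.linear scale s' (B a)" for a b
    using B by (simp_all add: bilinear_def)
  have "B (fst p) (snd p) = (\<Sum>g\<in>A. B g (scale (coef g (fst p)) (snd p)))"
    if p: "p \<in> Poly_Mapping.keys t" for p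
  proof -
    interpret B1: Vector_Spaces.linear scale s' "\<lambda>a. B a (snd p)" by (rule B1)
    interpret B2: Vector_Spaces.linear scale s' "B g" for g by (rule B2)
    have "fst p \<in> gr 0" using t p by (auto simp: tensors_from_def)
    then have "B (fst p) (snd p) = B (\<Sum>g\<in>A. scale (coef g (fst p)) g) (snd p)"
      using A(1) A(2)[OF p] by (subst sum_coef) auto
    then show ?thesis by (simp add: B1.sum B1.scale B2.scale)
  qed
  then have "lin_ext s' (\<lambda>(a, b). B a b) t =
      lin_ext s' (\<lambda>p. \<Sum>g\<in>A. B g (scale (coef g (fst p)) (snd p))) t"
    by (intro W.lin_ext_cong) (simp add: case_prod_unfold)
  also have "\<dots> = (\<Sum>g\<in>A. lin_ext s' (\<lambda>p. B g (scale (coef g (fst p)) (snd p))) t)"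
    unfolding lin_ext_def W.scale_sum_right by (rule sum.swap)
  finally show ?thesis
    by (simp add: linear_of_lin_ext[OF B2] case_prod_unfold)
qed

lemma lin_ext_gr_0_right:
  assumes B: "bilinear s' B" and t: "t \<in> tensors_from UNIV (gr 0)"
    and A: "finite A" "\<And>p g. p \<in> Poly_Mapping.keys t \<Longrightarrow> coef g (snd p) \<noteq> 0 \<Longrightarrow> g \<in> A"
  shows "lin_ext s' (\<lambda>(a, b). B a b) t =
    (\<Sum>g\<in>A. B (lin_ext scale (\<lambda>(a, b). scale (coef g b) a) t) g)"
proof -
  interpret W: vector_space s' using B by (rule bilinear_imp_vector_space)
  have B1: "Vector_Spaces.linear scale s' (\<lambda>a. B a b)" and B2: "Vector_Spaces.linear scale s' (B a)" for a b
    using B by (simp_all add: bilinear_def)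
  have "B (fst p) (snd p) = (\<Sum>g\<in>A. B (scale (coef g (snd p)) (fst p)) g)"
    if p: "p \<in> Poly_Mapping.keys t" for p
  proof -
    interpret B1: Vector_Spaces.linear scale s' "\<lambda>a. B a g" for g by (rule B1)
    interpret B2: Vector_Spaces.linear scale s' "B (fst p)" by (rule B2)
    have "snd p \<in> gr 0" using t p by (auto simp: tensors_from_def)
    then have "B (fst p) (snd p) = B (fst p) (\<Sum>g\<in>A. scale (coef g (snd p)) g)"
      using A(1) A(2)[OF p] by (subst sum_coef) auto
    then show ?thesis by (simp add: B2.sum B2.scale B1.scale)
  qed
  then have "lin_ext s' (\<lambda>(a, b). B a b) t =
      lin_ext s' (\<lambda>p. \<Sum>g\<in>A. B (scale (coef g (snd p)) (fst p)) g) t"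
    by (intro W.lin_ext_cong) (simp add: case_prod_unfold)
  also have "\<dots> = (\<Sum>g\<in>A. lin_ext s' (\<lambda>p. B (scale (coef g (snd p)) (fst p)) g) t)"
    unfolding lin_ext_def W.scale_sum_right by (rule sum.swap)
  finally show ?thesis
    by (simp add: linear_of_lin_ext[OF B1] case_prod_unfold)
qed

text \<open>In degree one the coproduct has just the components H(0) \<otimes> H(1) and H(1)
  \<otimes> H(0). As \<open>coef g\<close> kills H(1), each kind of part sees only one of
  them.\<close>

lemma gr_1_comult:
  assumes "h \<in> gr 1"
  obtains t u where "t \<in> tensors_from (gr 0) (gr 1)" "u \<in> tensors_from (gr 1) (gr 0)" "t + u \<in> \<Delta> h"
    "\<And>g. left_part g h = lin_ext scale (\<lambda>(a, b). scale (coef g a) b) t"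
    "\<And>g. right_part g h = lin_ext scale (\<lambda>(a, b). scale (coef g b) a) u"
proof -
  obtain v where v: "\<And>i. i \<le> 1 \<Longrightarrow> v i \<in> tensors_from (gr i) (gr (1 - i))" "(\<Sum>i\<le>1. v i) \<in> \<Delta> h"
    using gr_comult[OF assms] by blast
  define t u where "t = v 0" and "u = v 1"
  have t: "t \<in> tensors_from (gr 0) (gr 1)" using v(1)[of 0] by (simp add: t_def)
  have u: "u \<in> tensors_from (gr 1) (gr 0)" using v(1)[of 1] by (simp add: u_def)
  have tu: "t + u \<in> \<Delta> h" using v(2) by (simp add: t_def u_def)
  have "left_part g h = lin_ext scale (\<lambda>(a, b). scale (coef g a) b) t" for g
  proof -
    have "lin_ext scale (\<lambda>(a, b). scale (coef g a) b) u = 0"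
      using u by (intro lin_ext_eq_0) (auto simp: tensors_from_def coef_gr)
    then show ?thesis
      using lin_ext_comult[OF bilinear_left_part tu, of g] by (simp add: left_part_def lin_ext_add)
  qed
  moreover have "right_part g h = lin_ext scale (\<lambda>(a, b). scale (coef g b) a) u" for g
  proof -
    have "lin_ext scale (\<lambda>(a, b). scale (coef g b) a) t = 0"
      using t by (intro lin_ext_eq_0) (auto simp: tensors_from_def coef_gr)
    then show ?thesis
      using lin_ext_comult[OF bilinear_right_part tu, of g] by (simp add: right_part_def lin_ext_add)
  qed
  ultimately show thesis using that t u tu by blast
qed

lemma left_part_gr_1:
  assumes "h \<in> gr 1"
  shows "left_part g h \<in> gr 1"
  using assms
proof (rule gr_1_comult)
  fix t u assume t: "t \<in> tensors_from (gr 0) (gr 1)"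
    and "\<And>g. left_part g h = lin_ext scale (\<lambda>(a, b). scale (coef g a) b) t"
  then show ?thesis
    by (auto intro!: lin_ext_in_subspace subspace_gr subspace_scale simp: tensors_from_def)
qed

lemma right_part_gr_1:
  assumes "h \<in> gr 1"
  shows "right_part g h \<in> gr 1"
  using assms
proof (rule gr_1_comult)
  fix t u assume t: "u \<in> tensors_from (gr 1) (gr 0)"
    and "\<And>g. right_part g h = lin_ext scale (\<lambda>(a, b). scale (coef g b) a) u"
  then show ?thesis
    by (auto intro!: lin_ext_in_subspace subspace_gr subspace_scale simp: tensors_from_def)
qed

text \<open>This is \<Delta>(h) = \<Sum> g \<otimes> \<open>left_part g h\<close> +
  \<open>right_part g h\<close> \<otimes> g, tested against \<open>B\<close>. The index set is left
  free so that one set can serve both kinds of parts.\<close>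

lemma sweedler_gr_1:
  assumes h: "h \<in> gr 1" and B: "bilinear s' B"
    and A: "finite A" "{g. left_part g h \<noteq> 0} \<subseteq> A" "{g. right_part g h \<noteq> 0} \<subseteq> A"
  shows "sweedler s' h B = (\<Sum>g\<in>A. B g (left_part g h) + B (right_part g h) g)"
proof -
  interpret W: vector_space s' using B by (rule bilinear_imp_vector_space)
  interpret B1: Vector_Spaces.linear scale s' "\<lambda>a. B a b" for b using B by (simp add: bilinear_def)
  interpret B2: Vector_Spaces.linear scale s' "B a" for a using B by (simp add: bilinear_def)
  obtain t u where tu: "t \<in> tensors_from (gr 0) (gr 1)" "u \<in> tensors_from (gr 1) (gr 0)" "t + u \<in> \<Delta> h"
    and left: "\<And>g. left_part g h = lin_ext scale (\<lambda>(a, b). scale (coef g a) b) t"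
    and right: "\<And>g. right_part g h = lin_ext scale (\<lambda>(a, b). scale (coef g b) a) u"
    using h by (rule gr_1_comult) blast
  let ?T = "\<Union>p\<in>Poly_Mapping.keys t. {g. coef g (fst p) \<noteq> 0}"
  let ?U = "\<Union>p\<in>Poly_Mapping.keys u. {g. coef g (snd p) \<noteq> 0}"
  \<comment> \<open>The representatives may involve group-likes whose contributions cancel; they are
    added for the expansion and removed afterwards.\<close>
  let ?A = "A \<union> ?T \<union> ?U"
  have fin: "finite ?A" using A(1) by (simp add: finite_coef)
  have "lin_ext s' (\<lambda>(a, b). B a b) t = (\<Sum>g\<in>?A. B g (left_part g h))"
    unfolding left using tu(1) by (intro lin_ext_gr_0_left B fin) (auto simp: tensors_from_def)
  moreover have "lin_ext s' (\<lambda>(a, b). B a b) u = (\<Sum>g\<in>?A. B (right_part g h) g)"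
    unfolding right using tu(2) by (intro lin_ext_gr_0_right B fin) (auto simp: tensors_from_def)
  ultimately have "sweedler s' h B = (\<Sum>g\<in>?A. B g (left_part g h) + B (right_part g h) g)"
    using lin_ext_comult[OF B tu(3)] by (simp add: W.lin_ext_add sum.distrib)
  also have "\<dots> = (\<Sum>g\<in>A. B g (left_part g h) + B (right_part g h) g)"
  proof (rule sum.mono_neutral_right[OF fin])
    show "\<forall>g\<in>?A - A. B g (left_part g h) + B (right_part g h) g = 0"
    proof
      fix g assume "g \<in> ?A - A"
      then have "left_part g h = 0" "right_part g h = 0" using A by blast+
      then show "B g (left_part g h) + B (right_part g h) g = 0" by (simp add: B1.zero B2.zero)
    qed
  qed blast
  finally show ?thesis .
qed

lemma bilinear_counit_scale: "bilinear scale (\<lambda>a b. scale (\<epsilon> a) b)" "bilinear scale (\<lambda>a b. scale (\<epsilon> b) a)"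
  by (intro bilinearI linear_scale_left linear_scale_right counit_linear linear_ident)+

text \<open>Apply the counit to the first factor: it is 1 on each g and 0 on the right parts, which
  have degree one.\<close>

lemma sum_left_part:
  assumes "h \<in> gr 1"
  shows "(\<Sum>g | left_part g h \<noteq> 0 \<or> right_part g h \<noteq> 0. left_part g h) = h"
    (is "(\<Sum>g\<in>?A. _) = h")
proof -
  have fin: "finite ?A" unfolding Collect_disj_eq by (simp add: finite_left_part finite_right_part)
  have "h = sweedler scale h (\<lambda>a b. scale (\<epsilon> a) b)"
    by (rule sweedler_counit_left[OF linear_ident, symmetric])
  also have "\<dots> = (\<Sum>g\<in>?A. scale (\<epsilon> g) (left_part g h) + scale (\<epsilon> (right_part g h)) g)"
    by (rule sweedler_gr_1[OF assms bilinear_counit_scale(1) fin]) auto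
  also have "\<dots> = (\<Sum>g\<in>?A. left_part g h)"
  proof (rule sum.cong[OF refl])
    fix g assume "g \<in> ?A"
    then have "g \<in> group_likes" using left_part_nonzero right_part_nonzero by blast
    then show "scale (\<epsilon> g) (left_part g h) + scale (\<epsilon> (right_part g h)) g = left_part g h"
      by (simp add: counit_group_like gr_counit[OF right_part_gr_1[OF assms]])
  qed
  finally show ?thesis ..
qed

lemma sum_right_part:
  assumes "h \<in> gr 1"
  shows "(\<Sum>g | left_part g h \<noteq> 0 \<or> right_part g h \<noteq> 0. right_part g h) = h"
    (is "(\<Sum>g\<in>?A. _) = h")
proof -
  have fin: "finite ?A" unfolding Collect_disj_eq by (simp add: finite_left_part finite_right_part)
  have "h = sweedler scale h (\<lambda>a b. scale (\<epsilon> b) a)"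
    by (rule sweedler_counit_right[OF linear_ident, symmetric])
  also have "\<dots> = (\<Sum>g\<in>?A. scale (\<epsilon> (left_part g h)) g + scale (\<epsilon> g) (right_part g h))"
    by (rule sweedler_gr_1[OF assms bilinear_counit_scale(2) fin]) auto
  also have "\<dots> = (\<Sum>g\<in>?A. right_part g h)"
  proof (rule sum.cong[OF refl])
    fix g assume "g \<in> ?A"
    then have "g \<in> group_likes" using left_part_nonzero right_part_nonzero by blast
    then show "scale (\<epsilon> (left_part g h)) g + scale (\<epsilon> g) (right_part g h) = right_part g h"
      by (simp add: counit_group_like gr_counit[OF left_part_gr_1[OF assms]])
  qed
  finally show ?thesis ..
qed

text \<open>The element has a left part only at g and a right part only at g', so the expansion of
  its coproduct shrinks to two terms.\<close>

lemma skew_primitive_left_right_part: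
  assumes "h \<in> gr 1"
  shows "skew_primitive g g' (right_part g' (left_part g h))"
proof -
  define m where "m = right_part g' (left_part g h)"
  have m1: "m \<in> gr 1" unfolding m_def by (intro left_part_gr_1 right_part_gr_1 assms)
  have left: "left_part a m = (if a = g then m else 0)" for a
    by (simp add: m_def left_part_right_part left_part_left_part right_part.zero)
  have right: "right_part a m = (if a = g' then m else 0)" for a
    by (simp add: m_def right_part_right_part)
  show ?thesis
    unfolding m_def[symmetric] skew_primitive_def
  proof (rule in_comultI)
    fix B :: "'h \<Rightarrow> 'h \<Rightarrow> 'k" assume B: "bilinear (*) B"
    interpret B1: Vector_Spaces.linear scale "(*)" "\<lambda>a. B a b" for b using B by (simp add: bilinear_def)
    interpret B2: Vector_Spaces.linear scale "(*)" "B a" for a using B by (simp add: bilinear_def)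
    have "sweedler (*) m B = (\<Sum>a\<in>{g, g'}. B a (left_part a m) + B (right_part a m) a)"
      by (rule sweedler_gr_1[OF m1 B]) (auto simp: left right)
    \<comment> \<open>For g = g' the index set is a singleton whose single summand carries both
      terms.\<close>
    also have "\<dots> = B m g' + B g m"
      by (cases "g = g'") (simp_all add: left right B1.zero B2.zero)
    finally show "lin_ext (*) (\<lambda>(a, b). B a b)
        (Poly_Mapping.single (m, g') 1 + Poly_Mapping.single (g, m) 1) = sweedler (*) m B"
      by (simp add: vector_space.lin_ext_add[OF vector_space_field]
          vector_space.lin_ext_single[OF vector_space_field])
  qed
qed

text \<open>Splitting on the left and then on the right writes h as a double sum of skew-primitives.
  Zero pieces are set apart, because only a nonzero piece guarantees that g and g' are
  group-like.\<close>

lemma gr_1_subset_span: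
  "gr 1 \<subseteq> span {m. \<exists>g\<in>group_likes. \<exists>g'\<in>group_likes. skew_primitive g g' m}"
    (is "_ \<subseteq> span ?M")
proof
  fix h assume h: "h \<in> gr 1"
  have "right_part g' (left_part g h) \<in> span ?M" for g g'
  proof (cases "right_part g' (left_part g h) = 0")
    case False
    then have "g' \<in> group_likes" "left_part g h \<noteq> 0"
      using right_part_nonzero right_part.zero by force+
    then show ?thesis
      using left_part_nonzero skew_primitive_left_right_part[OF h] by (intro span_base) blast
  qed (simp add: span_zero)
  then have "left_part g h \<in> span ?M" for g
    by (subst sum_right_part[OF left_part_gr_1[OF h], symmetric]) (intro span_sum)
  then show "h \<in> span ?M"
    by (subst sum_left_part[OF h, symmetric]) (intro span_sum)
qed

section \<open>Rigidity of graded coalgebra maps above degree one\<close>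

lemma even_power_antipode_gr: "h \<in> gr n \<Longrightarrow> ((S \<circ> S) ^^ k) h \<in> gr n"
  by (induction k) (simp_all add: gr_antipode)

text \<open>In the coproduct of \<phi> h - h the components with both degrees below n cancel by
  induction. The two end components lie in H(n) \<otimes> H(0) and H(0) \<otimes> H(n), the shape
  that defines H_1.\<close>

lemma gr_fixed_of_coalgebra_map:
  assumes lin: "Vector_Spaces.linear scale scale \<phi>"
    and comult: "\<And>t h. t \<in> \<Delta> h \<Longrightarrow> tensor2_map \<phi> t \<in> \<Delta> (\<phi> h)"
    and gr: "\<And>n h. h \<in> gr n \<Longrightarrow> \<phi> h \<in> gr n"
    and fixed: "\<And>h. h \<in> gr 0 \<Longrightarrow> \<phi> h = h" "\<And>h. h \<in> gr 1 \<Longrightarrow> \<phi> h = h"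
  shows "h \<in> gr n \<Longrightarrow> \<phi> h = h"
proof (induction n arbitrary: h rule: less_induct)
  case (less n)
  show ?case
  proof (cases "n \<le> 1")
    case True
    then show ?thesis using less.prems fixed by (cases n) auto
  next
    case False
    define d where "d = \<phi> h - h"
    have d: "d \<in> gr n" unfolding d_def using less.prems gr by (intro subspace_diff subspace_gr)
    obtain t where t: "\<And>i. i \<le> n \<Longrightarrow> t i \<in> tensors_from (gr i) (gr (n - i))" "(\<Sum>i\<le>n. t i) \<in> \<Delta> h"
      using gr_comult[OF less.prems] by blast
    let ?r = "\<lambda>i. tensor2_map \<phi> (t i) - t i"
    have map_t: "Poly_Mapping.keys (?r i) \<subseteq> gr i \<times> gr (n - i)" if "i \<le> n" for i
    proof -
      have "Poly_Mapping.keys (t i) \<subseteq> gr i \<times> gr (n - i)"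
        using t(1)[OF that] by (simp add: tensors_from_def)
      moreover from this have "Poly_Mapping.keys (tensor2_map \<phi> (t i)) \<subseteq> gr i \<times> gr (n - i)"
        using keys_tensor2_map[of \<phi> "t i"] gr by fastforce
      ultimately show ?thesis using keys_diff[of "tensor2_map \<phi> (t i)" "t i"] by blast
    qed
    have "?r i = 0" if "i \<in> {..n} - {0, n}" for i
    proof -
      have "i < n" "n - i < n" "i \<le> n" using that by auto
      then have "tensor2_map \<phi> (t i) = t i"
        using t(1)[of i] less.IH by (intro tensor2_map_eq) (auto simp: tensors_from_def)
      then show ?thesis by simp
    qed
    then have "(\<Sum>i\<le>n. ?r i) = (\<Sum>i\<in>{0, n}. ?r i)"
      by (intro sum.mono_neutral_right) auto
    \<comment> \<open>Since n > 1 the indices 0 and n are distinct, so the sum has exactly two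
      terms.\<close>
    then have "tensor2_map \<phi> (\<Sum>i\<le>n. t i) - (\<Sum>i\<le>n. t i) = ?r n + ?r 0"
      using False by (simp add: tensor2_map_def free.lin_ext_sum sum_subtractf)
    then have "?r n + ?r 0 \<in> \<Delta> d"
      using comult_diff[OF comult[OF t(2)] t(2)] by (simp add: d_def)
    moreover have "?r n \<in> tensors_from UNIV (coradical_filtration 0)" "?r 0 \<in> tensors_from coradical UNIV"
      using map_t[of n] map_t[of 0] by (auto simp: tensors_from_def coradical_eq)
    ultimately have "d \<in> coradical_filtration (Suc 0)" by auto
    then obtain f where f: "d = (\<Sum>i\<le>Suc 0. f i)" "\<forall>i\<le>Suc 0. f i \<in> gr i"
      unfolding filtration_eq by blast
    have "d = component n d" using component_gr[OF d] by simp
    also have "\<dots> = component n (f 0) + component n (f 1)"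
      by (simp add: f(1) component.add)
    also have "\<dots> = 0"
      using f(2) False component_gr[of "f 0" 0 n] component_gr[of "f 1" 1 n] by auto
    finally show ?thesis by (simp add: d_def)
  qed
qed

lemma even_power_antipode_eq_id_iff:
  "(S \<circ> S) ^^ n = id \<longleftrightarrow> (\<forall>x\<in>group_likes. \<forall>p\<in>skew_primitives x. x ^ n * p = p * x ^ n)"
proof
  assume "(S \<circ> S) ^^ n = id"
  then show "\<forall>x\<in>group_likes. \<forall>p\<in>skew_primitives x. x ^ n * p = p * x ^ n"
    using even_power_antipode_fixes_iff[of _ _ n] by simp
next
  assume comm: "\<forall>x\<in>group_likes. \<forall>p\<in>skew_primitives x. x ^ n * p = p * x ^ n"
  let ?\<phi> = "(S \<circ> S) ^^ n"
  interpret vector_space_pair scale scale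
    using vector_space_scale by (intro vector_space_pair.intro)
  have id: "Vector_Spaces.linear scale scale id"
    unfolding id_def by (rule linear_ident)
  note lin = linear_even_power_antipode[of n]
  have "?\<phi> h = id h" if "h \<in> gr 0" for h
    by (rule linear_eq_gr_0[OF lin id _ that]) (simp add: even_power_antipode_group_like)
  moreover have "?\<phi> h = id h" if "h \<in> gr 1" for h
  proof (rule linear_eq_on[OF lin id])
    show "h \<in> span {m. \<exists>g\<in>group_likes. \<exists>g'\<in>group_likes. skew_primitive g g' m}"
      using that gr_1_subset_span by blast
    fix m assume "m \<in> {m. \<exists>g\<in>group_likes. \<exists>g'\<in>group_likes. skew_primitive g g' m}"
    then obtain g g' where "g \<in> group_likes" "g' \<in> group_likes" "skew_primitive g g' m" by blast
    then show "?\<phi> m = id m"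
      using even_power_antipode_fixes_skew_primitive[of n g g' m] comm by simp
  qed
  ultimately have fixed: "?\<phi> h = id h" if "h \<in> gr k" for h k
    using gr_fixed_of_coalgebra_map[OF lin comult_even_power_antipode even_power_antipode_gr _ _ that]
    by simp
  have "?\<phi> h = id h" for h
    by (rule linear_eq_gr[OF lin id fixed])
  then show "?\<phi> = id" by blast
qed

end

section \<open>The order of the antipode\<close>

lemma funpow_double: "f ^^ (2 * n) = (f \<circ> f) ^^ n"
  by (induction n) (simp_all add: o_assoc)

lemma funpow_double_eq_id: "f ^^ n = id \<Longrightarrow> f ^^ (2 * n) = id"
  by (simp add: mult_2 funpow_add)

text \<open>The quotient by \<open>C\<close> is cyclic, generated by the coset of x, so the order of
  that coset is the index.\<close>

lemma (in group) pow_in_subgroup_iff_index_dvd: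
  assumes x: "x \<in> carrier G" and gen: "generate G {x} = carrier G" and C: "subgroup C G"
  shows "x [^] (n::nat) \<in> C \<longleftrightarrow> card (rcosets C) dvd n"
proof -
  have powers: "\<exists>i::int. y = x [^] i" if "y \<in> carrier G" for y
    using that generate_pow[OF x] gen by blast
  \<comment> \<open>A group generated by one element is abelian, which makes \<open>C\<close> normal
    and the quotient a group.\<close>
  interpret comm_group G
  proof (rule group_comm_groupI)
    fix y z assume "y \<in> carrier G" "z \<in> carrier G"
    then obtain i j :: int where "y = x [^] i" "z = x [^] j" using powers by blast
    then show "y \<otimes> z = z \<otimes> y"
      using int_pow_mult[OF x, of i j] int_pow_mult[OF x, of j i] by (simp add: add.commute)
  qed
  interpret C: normal C G using C by (rule subgroup_imp_normal)
  interpret Q: group "G Mod C" by (rule C.factorgroup_is_group)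
  let ?q = "C #> x"
  have q: "?q \<in> carrier (G Mod C)" using x by (auto simp: carrier_FactGroup)
  have "carrier (G Mod C) \<subseteq> generate (G Mod C) {?q}"
  proof
    fix D assume "D \<in> carrier (G Mod C)"
    then obtain y where y: "y \<in> carrier G" "D = C #> y" by (auto simp: carrier_FactGroup)
    with powers obtain i :: int where "D = C #> (x [^] i)" by blast
    then show "D \<in> generate (G Mod C) {?q}"
      using C.FactGroup_int_pow[OF x, of i] Q.generate_pow[OF q] by blast
  qed
  then have "generate (G Mod C) {?q} = rcosets C"
    using Q.generate_incl[of "{?q}"] q by (auto simp: FactGroup_def)
  \<comment> \<open>This includes infinite index: both sides are then 0, and 0 divides only n =
    0.\<close>
  then have "Q.ord ?q = card (rcosets C)"
    using Q.generate_pow_card[OF q] by simp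
  moreover have "x [^] n \<in> C \<longleftrightarrow> C #> (x [^] n) = C"
    using coset_join1[OF _ _ C] coset_join2[OF _ C] x by blast
  moreover have "C #> (x [^] n) = C \<longleftrightarrow> ?q [^]\<^bsub>G Mod C\<^esub> n = \<one>\<^bsub>G Mod C\<^esub>"
    by (simp add: C.FactGroup_pow[OF x])
  ultimately show ?thesis using Q.pow_eq_id[OF q, of n] by simp
qed

section \<open>The group of group-likes and the indices a_x\<close>

context hopf_algebra
begin

lemma group_group_like_group: "group group_like_group"
proof (rule groupI)
  fix x assume "x \<in> carrier group_like_group"
  then show "\<exists>y\<in>carrier group_like_group. y \<otimes>\<^bsub>group_like_group\<^esub> x = \<one>\<^bsub>group_like_group\<^esub>"
    using antipode_group_like antipode_group_like_left by (auto simp: group_like_group_def)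
qed (auto simp: group_like_group_def one_group_like mult_group_like mult.assoc)

sublocale group_like_group: group group_like_group
  by (rule group_group_like_group)

lemma group_like_group_pow: "x [^]\<^bsub>group_like_group\<^esub> (n::nat) = x ^ n"
  by (induction n) (simp_all add: group_like_group_def power_Suc2 del: power_Suc)

lemma group_like_group_simps [simp]:
  "carrier group_like_group = group_likes" "x \<otimes>\<^bsub>group_like_group\<^esub> y = x * y"
  "\<one>\<^bsub>group_like_group\<^esub> = 1"
  by (simp_all add: group_like_group_def)

lemma subgroup_cyclic_subgroup:
  "x \<in> group_likes \<Longrightarrow> subgroup (cyclic_subgroup x) group_like_group"
  unfolding cyclic_subgroup_def by (rule group_like_group.generate_is_subgroup) simp

lemma subgroup_skew_centralizer:
  assumes "x \<in> group_likes"
  shows "subgroup (skew_centralizer x) group_like_group"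
proof -
  interpret Z: subgroup "cyclic_subgroup x" group_like_group
    using assms by (rule subgroup_cyclic_subgroup)
  show ?thesis
  proof (rule group_like_group.subgroupI)
    show "skew_centralizer x \<subseteq> carrier group_like_group"
      using Z.subset by (auto simp: skew_centralizer_def)
    show "skew_centralizer x \<noteq> {}"
      using Z.one_closed by (auto simp: skew_centralizer_def intro!: exI[of _ 1])
  next
    fix y assume y: "y \<in> skew_centralizer x"
    let ?i = "inv\<^bsub>group_like_group\<^esub> y"
    have yc: "y \<in> carrier group_like_group" "y \<in> cyclic_subgroup x"
      using y Z.subset by (auto simp: skew_centralizer_def)
    have inv: "?i * y = 1" "y * ?i = 1"
      using group_like_group.l_inv[OF yc(1)] group_like_group.r_inv[OF yc(1)] by simp_all
    have "?i * h = h * ?i" if "h \<in> skew_primitives x" for h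
    proof -
      have "?i * h = ?i * (h * y) * ?i" by (simp add: mult.assoc inv)
      also have "\<dots> = ?i * (y * h) * ?i" using y that by (simp add: skew_centralizer_def)
      also have "\<dots> = ?i * y * h * ?i" by (simp only: mult.assoc)
      finally show ?thesis by (simp add: inv)
    qed
    then show "?i \<in> skew_centralizer x"
      using Z.m_inv_closed[OF yc(2)] by (simp add: skew_centralizer_def)
  next
    fix y z assume "y \<in> skew_centralizer x" "z \<in> skew_centralizer x"
    then have yz: "y \<in> cyclic_subgroup x" "z \<in> cyclic_subgroup x"
      and y: "\<And>h. h \<in> skew_primitives x \<Longrightarrow> y * h = h * y"
      and z: "\<And>h. h \<in> skew_primitives x \<Longrightarrow> z * h = h * z"
      by (auto simp: skew_centralizer_def)
    have "y * z * h = h * (y * z)" if "h \<in> skew_primitives x" for h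
      using y[OF that] z[OF that] by (metis mult.assoc)
    then show "y \<otimes>\<^bsub>group_like_group\<^esub> z \<in> skew_centralizer x"
      using Z.m_closed[OF yz] by (simp add: skew_centralizer_def)
  qed
qed

text \<open>x^n always lies in the cyclic group of x, so the commutation condition says that it lies
  in the centralizer, and the index of a subgroup of a cyclic group decides this.\<close>

lemma conj_index_dvd_iff:
  assumes x: "x \<in> group_likes" and n: "n \<ge> 1"
  shows "(\<exists>a. conj_index x = enat a \<and> a dvd n) \<longleftrightarrow> (\<forall>p\<in>skew_primitives x. x ^ n * p = p * x ^ n)"
proof -
  let ?Z = "cyclic_subgroup x"
  let ?K = "group_like_group\<lparr>carrier := ?Z\<rparr>"
  let ?Q = "rcosets\<^bsub>?K\<^esub> (skew_centralizer x)"
  note Z = subgroup_cyclic_subgroup[OF x]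
  interpret K: group ?K by (rule group_like_group.subgroup_imp_group[OF Z])
  have xZ: "x \<in> ?Z" by (simp add: cyclic_subgroup_def generate.incl)
  have pow: "x [^]\<^bsub>?K\<^esub> n = x ^ n"
    by (simp add: nat_pow_def group_like_group_pow[unfolded nat_pow_def, symmetric])
  have "x ^ n \<in> skew_centralizer x \<longleftrightarrow> card ?Q dvd n"
    unfolding pow[symmetric]
  proof (rule K.pow_in_subgroup_iff_index_dvd)
    show "generate ?K {x} = carrier ?K"
      using group_like_group.generate_consistent[OF _ Z, of "{x}"] xZ
      by (simp add: cyclic_subgroup_def)
    show "subgroup (skew_centralizer x) ?K"
      using group_like_group.subgroup_incl[OF subgroup_skew_centralizer[OF x] Z]
      by (auto simp: skew_centralizer_def)
  qed (simp add: xZ)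
  moreover have "x ^ n \<in> ?Z"
    using K.nat_pow_closed[of x n] xZ by (simp add: pow)
  \<comment> \<open>If the quotient is infinite, the left side fails and the cardinality is 0, which
    does not divide n \<ge> 1.\<close>
  moreover have "(\<exists>a. conj_index x = enat a \<and> a dvd n) \<longleftrightarrow> card ?Q dvd n"
    using n by (auto simp: conj_index_def Let_def)
  ultimately show ?thesis by (simp add: skew_centralizer_def)
qed

end

section \<open>From the criterion for even exponents to the exact order\<close>

context pointed_coradically_graded_hopf_algebra
begin

lemma even_power_antipode_eq_id_iff_index:
  assumes "n \<ge> 1"
  shows "S ^^ (2 * n) = id \<longleftrightarrow> (\<forall>x\<in>group_likes. \<exists>a. conj_index x = enat a \<and> a dvd n)"
  unfolding funpow_double even_power_antipode_eq_id_iff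
  using conj_index_dvd_iff[OF _ assms] by blast

lemma antipode_odd_order:
  assumes "S ^^ n = id" "odd n"
  shows "S = id"
proof -
  obtain k where k: "n = Suc (2 * k)" using assms(2) by (auto elim: oddE)
  have pow: "S ^^ n = S \<circ> (S \<circ> S) ^^ k"
    by (simp add: k flip: funpow_double)
  have "x ^ n = x" if "x \<in> group_likes" for x
  proof -
    have "S x = (S ^^ n) x" by (simp add: pow even_power_antipode_group_like that)
    then have "x * x = 1" using antipode_group_like_left[OF that] assms(1) by simp
    then show ?thesis by (simp add: k power_mult power2_eq_square)
  qed
  moreover have "(S \<circ> S) ^^ n = id"
    using funpow_double_eq_id[OF assms(1)] by (simp only: funpow_double)
  \<comment> \<open>With x^n = x the commutation criteria for the exponents n and 1
    coincide.\<close>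
  ultimately have "(S \<circ> S) ^^ 1 = id"
    unfolding even_power_antipode_eq_id_iff by simp
  then have "S \<circ> S = id" by simp
  with pow assms(1) show ?thesis by (simp add: id_def[symmetric])
qed

text \<open>Doubling an exponent does not affect finiteness, and for even exponents the criterion is
  the very condition that makes \<open>m_H\<close> finite.\<close>

lemma antipode_finite_order_iff: "(\<exists>n\<ge>1. S ^^ n = id) \<longleftrightarrow> m_H \<noteq> \<infinity>"
proof -
  have "(\<exists>n\<ge>1. S ^^ n = id) \<longleftrightarrow> (\<exists>n\<ge>1. S ^^ (2 * n) = id)"
  proof
    assume "\<exists>n\<ge>1. S ^^ n = id"
    then show "\<exists>n\<ge>1. S ^^ (2 * n) = id" using funpow_double_eq_id by blast
  next
    assume "\<exists>n\<ge>1. S ^^ (2 * n) = id"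
    then obtain n where "n \<ge> 1" "S ^^ (2 * n) = id" by blast
    then show "\<exists>n\<ge>1. S ^^ n = id" by (intro exI[of _ "2 * n"]) simp
  qed
  also have "\<dots> \<longleftrightarrow> (\<exists>n\<ge>1. \<forall>x\<in>group_likes. \<exists>a. conj_index x = enat a \<and> a dvd n)"
    using even_power_antipode_eq_id_iff_index by blast
  finally show ?thesis by (simp add: m_H_def)
qed

lemma even_power_antipode_eq_id_iff_dvd:
  assumes "m_H = enat M" "n \<ge> 1"
  shows "S ^^ (2 * n) = id \<longleftrightarrow> M dvd n"
proof -
  let ?A = "{a. \<exists>x\<in>group_likes. conj_index x = enat a}"
  have "\<exists>N\<ge>1. \<forall>x\<in>group_likes. \<exists>a. conj_index x = enat a \<and> a dvd N"
    using assms(1) unfolding m_H_def by (metis enat.distinct(1))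
  then have fin: "\<forall>x\<in>group_likes. \<exists>a. conj_index x = enat a" and M: "M = Lcm ?A"
    using assms(1) by (blast, simp add: m_H_def)
  show ?thesis
    unfolding even_power_antipode_eq_id_iff_index[OF assms(2)] M
  proof
    assume "\<forall>x\<in>group_likes. \<exists>a. conj_index x = enat a \<and> a dvd n"
    then show "Lcm ?A dvd n" by (intro Lcm_least) force
  next
    assume "Lcm ?A dvd n"
    then have "a dvd n" if "x \<in> group_likes" "conj_index x = enat a" for x a
      using that dvd_Lcm[of a ?A] dvd_trans[of a "Lcm ?A" n] by blast
    with fin show "\<forall>x\<in>group_likes. \<exists>a. conj_index x = enat a \<and> a dvd n" by blast
  qed
qed

text \<open>As S \<noteq> id rules out odd exponents, every k \<ge> 1 with S^k = id is even, and its
  half is then a multiple of M.\<close>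

lemma map_order_antipode:
  assumes "m_H \<noteq> \<infinity>" "S \<noteq> id"
  shows "map_order S = 2 * m_H"
proof -
  obtain M where M: "m_H = enat M" using assms(1) by auto
  obtain n where "n \<ge> 1" "S ^^ n = id"
    using assms(1) antipode_finite_order_iff by blast
  have dvd: "S ^^ k = id \<Longrightarrow> k \<ge> 1 \<Longrightarrow> 2 * M dvd k" for k
  proof -
    assume k: "S ^^ k = id" "k \<ge> 1"
    then obtain j where "k = 2 * j" using antipode_odd_order assms(2) by blast
    then show "2 * M dvd k" using k even_power_antipode_eq_id_iff_dvd[OF M, of j] by simp
  qed
  \<comment> \<open>M = 0 would make 0 divide the positive exponent n.\<close>
  have "M \<ge> 1" using dvd[of n] \<open>n \<ge> 1\<close> \<open>S ^^ n = id\<close> by (cases M) auto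
  then have "S ^^ (2 * M) = id" using even_power_antipode_eq_id_iff_dvd[OF M, of M] by simp
  with \<open>M \<ge> 1\<close> have "(LEAST k. k \<ge> 1 \<and> S ^^ k = id) = 2 * M"
    using dvd by (intro Least_equality) (simp, meson dvd_imp_le less_le_trans zero_less_one)
  then have "map_order S = enat (2 * M)"
    using \<open>n \<ge> 1\<close> \<open>S ^^ n = id\<close> by (auto simp: map_order_def)
  then show ?thesis by (simp add: M numeral_eq_enat)
qed

end

theorem proposition1p4:
  fixes scale :: "'k::field \<Rightarrow> 'h::ring_1 \<Rightarrow> 'h"
    and \<Delta> :: "'h \<Rightarrow> ('h \<times> 'h \<Rightarrow>\<^sub>0 'k) set"
    and \<epsilon> :: "'h \<Rightarrow> 'k"
    and S :: "'h \<Rightarrow> 'h"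
    and H :: "nat \<Rightarrow> 'h set"
  assumes "hopf_algebra scale \<Delta> \<epsilon> S"
    and "hopf_algebra.pointed scale \<Delta>"
    and "hopf_algebra.coradical_grading scale \<Delta> \<epsilon> S H"
  shows "(map_order S = \<infinity> \<longleftrightarrow> hopf_algebra.m_H \<Delta> = \<infinity>) \<and>
    (hopf_algebra.m_H \<Delta> < \<infinity> \<longrightarrow> S = id \<or> map_order S = 2 * hopf_algebra.m_H \<Delta>)"
proof -
  interpret pointed_coradically_graded_hopf_algebra scale \<Delta> \<epsilon> S H
    using assms by (intro pointed_coradically_graded_hopf_algebra.intro
        pointed_coradically_graded_hopf_algebra_axioms.intro)
  have "map_order S = \<infinity> \<longleftrightarrow> m_H = \<infinity>"
    using antipode_finite_order_iff by (auto simp: map_order_def)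
  then show ?thesis using map_order_antipode by auto
qed

end
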